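(* Let $X$ be a random vector in $\mathbb{R}^q$ and let $Y$ be a categorical random variable with $K$ values $L_1,\dots,L_K$, where $p_k=\Pr(Y=L_k)\in(0,1)$ for each $k$. For any bounded Mercer kernel $\kappa:\mathbb{R}^q\times\mathbb{R}^q\to\mathbb{R}$, $\mathrm{gCov}_\kappa(X,Y)=0$ if and only if $X$ and $Y$ are independent. The same result holds for $\mathrm{gCor}_\kappa(X,Y)$ assuming that the marginal distribution of $X$ is not degenerate: in that case $\mathrm{gCor}_\kappa(X,Y)=0$ if and only if $X$ and $Y$ are independent.
   Context: A Mercer kernel on $\mathbb{R}^q$ is a positive definite kernel $\kappa:\mathbb{R}^q\times\mathbb{R}^q\to\mathbb{R}$. It has an associated reproducing kernel Hilbert space $\mathcal{H}_\kappa$ of real functions on $\mathbb{R}^q$ with reproducing kernel $\kappa$, and the function $$d_\kappa(x,x')=\sqrt{\kappa(x,x)+\kappa(x',x')-2\kappa(x,x')}$$ defines a distance in $\mathcal{H}_\kappa$ (the distance between the images of $x$ and $x'$ in $\mathcal{H}_\kappa$). Let $F$ be the distribution of $X$ and $F_k$ the conditional distribution of $X$ given $Y=L_k$, so $F=\sum_{k=1}^K p_kF_k$. In the expectations below, $X,X'$ have distribution $F$, $X_k,X_k'$ have distribution $F_k$, and the two arguments of $d_\kappa$ are always independent of each other. Define $$\mathrm{gCov}_\kappa(X,Y)=\sum_{k=1}^K p_k\left[2\,\mathbb{E}d_\kappa(X_k,X)-\mathbb{E}d_\kappa(X_k,X_k')-\mathbb{E}d_\kappa(X,X')\right],\qquad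 \mathrm{gCor}_\kappa(X,Y)=\frac{\mathrm{gCov}_\kappa(X,Y)}{\mathbb{E}d_\kappa(X,X')}.$$ A distribution is degenerate if it is a single point mass.
   Formalization: Mercer kernels are taken to be continuous, and d_κ is assumed to separate points of R^q (to be a metric there); the claim fails otherwise, e.g. for constant κ, or for κ(x,x')=1[x=x'] with X atomless. *)

theory Defs
  imports "HOL-Probability.Probability"
begin

text \<open>
  Mercer kernels are taken to be continuous, as in Mercer's theorem. Positive definiteness is
  the usual condition on Gram matrices, which is not strict; hence \<open>kernel_dist\<close> below is in
  general only a pseudometric, and that it is a metric is a separate (weaker than strict
  positive definiteness) condition, without which constant kernels would be allowed.
\<close>

definition positive_definite_kernel :: "('v \<Rightarrow> 'v \<Rightarrow> real) \<Rightarrow> bool" where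
  "positive_definite_kernel \<kappa> \<longleftrightarrow>
     (\<forall>x y. \<kappa> x y = \<kappa> y x) \<and>
     (\<forall>S c. finite S \<longrightarrow> 0 \<le> (\<Sum>x\<in>S. \<Sum>y\<in>S. c x * c y * \<kappa> x y))"

definition Mercer_kernel :: "('v::topological_space \<Rightarrow> 'v \<Rightarrow> real) \<Rightarrow> bool" where
  "Mercer_kernel \<kappa> \<longleftrightarrow>
     positive_definite_kernel \<kappa> \<and> continuous_on UNIV (\<lambda>(x, y). \<kappa> x y)"

definition bounded_kernel :: "('v \<Rightarrow> 'v \<Rightarrow> real) \<Rightarrow> bool" where
  "bounded_kernel \<kappa> \<longleftrightarrow> (\<exists>B. \<forall>x y. \<bar>\<kappa> x y\<bar> \<le> B)"

definition kernel_dist :: "('v \<Rightarrow> 'v \<Rightarrow> real) \<Rightarrow> 'v \<Rightarrow> 'v \<Rightarrow> real" where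
  "kernel_dist \<kappa> x x' = sqrt (\<kappa> x x + \<kappa> x' x' - 2 * \<kappa> x x')"

text \<open>
  The expected distance between two independent random elements with distributions \<open>P\<close> and
  \<open>Q\<close>; independence is expressed by the product measure.
\<close>

definition expected_dist :: "('v \<Rightarrow> 'v \<Rightarrow> real) \<Rightarrow> 'v measure \<Rightarrow> 'v measure \<Rightarrow> real" where
  "expected_dist \<kappa> P Q = (\<integral>(x, x'). kernel_dist \<kappa> x x' \<partial>(P \<Otimes>\<^sub>M Q))"

definition distribution_of :: "'a measure \<Rightarrow> ('a \<Rightarrow> 'v::topological_space) \<Rightarrow> 'v measure" where
  "distribution_of M X = distr M borel X"

definition event_eq :: "'a measure \<Rightarrow> ('a \<Rightarrow> 'l) \<Rightarrow> 'l \<Rightarrow> 'a set" where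
  "event_eq M Y l = {\<omega> \<in> space M. Y \<omega> = l}"

text \<open>
  \<^const>\<open>uniform_measure\<close> \<open>M A\<close> is the probability measure \<open>M\<close> conditioned on the event \<open>A\<close>.
\<close>

definition cond_distribution ::
    "'a measure \<Rightarrow> ('a \<Rightarrow> 'v::topological_space) \<Rightarrow> ('a \<Rightarrow> 'l) \<Rightarrow> 'l \<Rightarrow> 'v measure" where
  "cond_distribution M X Y l = distr (uniform_measure M (event_eq M Y l)) borel X"

definition gCov ::
    "('v::topological_space \<Rightarrow> 'v \<Rightarrow> real) \<Rightarrow> 'a measure \<Rightarrow> nat \<Rightarrow> (nat \<Rightarrow> 'l) \<Rightarrow>
     ('a \<Rightarrow> 'v) \<Rightarrow> ('a \<Rightarrow> 'l) \<Rightarrow> real" where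
  "gCov \<kappa> M K L X Y =
     (\<Sum>k=1..K. measure M (event_eq M Y (L k)) *
        (2 * expected_dist \<kappa> (cond_distribution M X Y (L k)) (distribution_of M X)
         - expected_dist \<kappa> (cond_distribution M X Y (L k)) (cond_distribution M X Y (L k))
         - expected_dist \<kappa> (distribution_of M X) (distribution_of M X)))"

definition gCor ::
    "('v::topological_space \<Rightarrow> 'v \<Rightarrow> real) \<Rightarrow> 'a measure \<Rightarrow> nat \<Rightarrow> (nat \<Rightarrow> 'l) \<Rightarrow>
     ('a \<Rightarrow> 'v) \<Rightarrow> ('a \<Rightarrow> 'l) \<Rightarrow> real" where
  "gCor \<kappa> M K L X Y =
     gCov \<kappa> M K L X Y / expected_dist \<kappa> (distribution_of M X) (distribution_of M X)"

definition degenerate :: "'v::topological_space measure \<Rightarrow> bool" where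
  "degenerate P \<longleftrightarrow> (\<exists>a. P = return borel a)"

text \<open>
  The library's \<open>prob_space.indep_var\<close> requires both random variables to take values in the same
  type. The following is its two-type version, cf. \<open>prob_space.indep_var_eq\<close>; the preimages form
  \<open>\<sigma>\<close>-algebras already, so no generation is needed.
\<close>

definition indep_random_variables ::
    "'a measure \<Rightarrow> 'v measure \<Rightarrow> ('a \<Rightarrow> 'v) \<Rightarrow> 'l measure \<Rightarrow> ('a \<Rightarrow> 'l) \<Rightarrow> bool" where
  "indep_random_variables M S X T Y \<longleftrightarrow>
     X \<in> measurable M S \<and> Y \<in> measurable M T \<and>
     prob_space.indep_set M {X -` A \<inter> space M |A. A \<in> sets S}
                            {Y -` B \<inter> space M |B. B \<in> sets T}"

end

theory Submission
  imports Defs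
begin

text \<open>
  With \<open>g = 1\<^bsub>{Y = L k}\<^esub> / p\<^sub>k - 1\<close>, the \<open>k\<close>-th bracket of \<open>gCov\<close> is \<open>- E g g' d(X, X')\<close>.
  By Bernstein's formula \<open>c * sqrt \<delta> = \<integral> (1 - exp (- u\<^sup>2 * \<delta>)) / u\<^sup>2 du\<close> for \<open>\<delta> = d\<^sup>2\<close>, this is an
  integral of the Gaussian energies \<open>E g g' exp (- t * \<delta>(X, X'))\<close>, which are nonnegative because
  \<open>exp (- t * \<delta>)\<close> is positive definite. So it is nonnegative, and if it vanishes then so do all
  Gaussian energies. Testing against the barycentre of points \<open>y\<^sub>1, \<dots>, y\<^sub>n\<close> in the reproducing kernel
  Hilbert space yields \<open>E g exp (- \<Sum> \<delta>(X, y\<^sub>i)) = 0\<close>. By Weierstrass approximation in one factor at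
  a time, \<open>g\<close> then annihilates all finite intersections of \<open>d\<close>-balls, and these generate the Borel
  sets.
\<close>

subsection \<open>Positive definite kernels\<close>

text \<open>The Hilbert space is never constructed: inner product arguments become statements about
  Gram sums, so kernels on lists and sums over pairs or options appear. The square root is resolved
  into Gaussians because, by positivity, one vanishing scalar then forces a whole family of energies
  to vanish. The obstacle comes afterwards: balls are not stable under intersection, so the
  uniqueness argument for measures requires \<open>g\<close> to annihilate finite intersections of
  balls. Their indicators are limits of products of functions of single distances, and approximating
  these by polynomials leads to products of Gaussians with several centres. Up to a constant factor
  such a product is one Gaussian at the barycentre of the centres, which need not be the image of a
  point of R^q; this is why the test vector lies in the Hilbert space. Repeated centres supply the
  powers in the polynomials.\<close>

lemma pd_indexed:
  assumes "positive_definite_kernel \<kappa>" "finite I"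
  shows "0 \<le> (\<Sum>i\<in>I. \<Sum>j\<in>I. c i * c j * \<kappa> (p i) (p j))"
proof -
  \<comment> \<open>Weights of indices with the same point are merged, since the definition sums
    over sets of distinct points.\<close>
  define e where "e x = (\<Sum>i\<in>{i\<in>I. p i = x}. c i)" for x
  have one: "(\<Sum>i\<in>I. c i * f (p i)) = (\<Sum>x\<in>p ` I. e x * f x)" for f :: "'a \<Rightarrow> real"
    unfolding e_def by (subst sum.image_gen[OF assms(2), of _ p]) (auto simp: sum_distrib_right intro!: sum.cong)
  have "(\<Sum>i\<in>I. \<Sum>j\<in>I. c i * c j * \<kappa> (p i) (p j)) = (\<Sum>i\<in>I. c i * (\<Sum>j\<in>I. c j * \<kappa> (p i) (p j)))"
    by (simp add: sum_distrib_left mult.assoc)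
  also have "\<dots> = (\<Sum>x\<in>p ` I. e x * (\<Sum>y\<in>p ` I. e y * \<kappa> x y))"
    by (simp only: one one[of "\<lambda>x. \<Sum>y\<in>p ` I. e y * \<kappa> x y"])
  also have "\<dots> = (\<Sum>x\<in>p ` I. \<Sum>y\<in>p ` I. e x * e y * \<kappa> x y)"
    by (simp add: sum_distrib_left mult.assoc)
  also have "\<dots> \<ge> 0"
    using assms unfolding positive_definite_kernel_def by blast
  finally show ?thesis .
qed

lemma pd_sym: "positive_definite_kernel \<kappa> \<Longrightarrow> \<kappa> x y = \<kappa> y x"
  unfolding positive_definite_kernel_def by blast

lemma pd_pair:
  assumes "positive_definite_kernel \<kappa>"
  shows "0 \<le> a\<^sup>2 * \<kappa> x x + 2 * a * b * \<kappa> x y + b\<^sup>2 * \<kappa> y y"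
proof -
  have "0 \<le> (\<Sum>i\<in>UNIV. \<Sum>j\<in>UNIV. (if i then a else b) * (if j then a else b)
      * \<kappa> (if i then x else y) (if j then x else y))"
    by (rule pd_indexed[OF assms]) simp
  then show ?thesis
    using pd_sym[OF assms, of x y] by (simp add: UNIV_bool power2_eq_square algebra_simps)
qed

lemma pd_diag: "positive_definite_kernel \<kappa> \<Longrightarrow> 0 \<le> \<kappa> x x"
  using pd_pair[of \<kappa> 1 x 0 x] by simp

lemma pd_zero_diag:
  assumes pd: "positive_definite_kernel \<kappa>" and z: "\<kappa> z z = 0"
  shows "\<kappa> x z = 0"
proof -
  have "0 \<le> \<kappa> x x + 2 * b * \<kappa> x z" for b
    using pd_pair[OF pd, of 1 x b z] z by simp
  \<comment> \<open>The bound is affine in \<open>b\<close>; at this \<open>b\<close> it would read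
    \<open>0 \<le> - 1\<close>.\<close>
  from this[of "- (\<kappa> x x + 1) / (2 * \<kappa> x z)"] show ?thesis
    by (cases "\<kappa> x z = 0") (auto simp: field_simps)
qed

text \<open>Gram kernel of the components orthogonal to the image of \<open>z\<close>. If
  \<open>\<kappa> z z = 0\<close>, division by zero makes the correction vanish.\<close>

lemma pd_schur_complement:
  assumes pd: "positive_definite_kernel \<kappa>"
  shows "positive_definite_kernel (\<lambda>x y. \<kappa> x y - \<kappa> x z * \<kappa> y z / \<kappa> z z)"
proof (cases "\<kappa> z z = 0")
  case True
  then show ?thesis using pd by simp
next
  case False
  then have pos: "\<kappa> z z > 0" using pd_diag[OF pd, of z] by simp
  show ?thesis
    unfolding positive_definite_kernel_def
  proof (intro conjI allI impI)
    show "\<kappa> x y - \<kappa> x z * \<kappa> y z / \<kappa> z z = \<kappa> y x - \<kappa> y z * \<kappa> x z / \<kappa> z z" for x y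
      using pd_sym[OF pd, of x y] by simp
    fix S :: "'a set" and c :: "'a \<Rightarrow> real"
    assume S: "finite S"
    \<comment> \<open>Coefficient of the orthogonal projection onto the image of \<open>z\<close>:
      the extra weight \<open>- t\<close> at \<open>z\<close> minimises the quadratic form.\<close>
    define t where "t = (\<Sum>x\<in>S. c x * \<kappa> x z) / \<kappa> z z"
    have t: "(\<Sum>x\<in>S. c x * \<kappa> x z) = t * \<kappa> z z" using pos by (simp add: t_def)
    have t': "(\<Sum>x\<in>S. c x * \<kappa> z x) = t * \<kappa> z z" unfolding t[symmetric] by (intro sum.cong refl) (metis pd_sym[OF pd])
    \<comment> \<open>\<open>None\<close> is an extra copy of \<open>z\<close>, kept apart from a
      possible occurrence of \<open>z\<close> in \<open>S\<close>.\<close>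
    let ?I = "insert None (Some ` S)"
    let ?c = "case_option (- t) c" and ?p = "case_option z id"
    have eq: "(\<Sum>i\<in>?I. f i) = f None + (\<Sum>x\<in>S. f (Some x))" for f :: "'a option \<Rightarrow> real"
      using S by (subst sum.insert) (auto simp: sum.reindex)
    have "0 \<le> (\<Sum>i\<in>?I. \<Sum>j\<in>?I. ?c i * ?c j * \<kappa> (?p i) (?p j))"
      by (rule pd_indexed[OF pd]) (use S in auto)
    also have "\<dots> = t\<^sup>2 * \<kappa> z z - t * (\<Sum>x\<in>S. c x * \<kappa> z x) - t * (\<Sum>x\<in>S. c x * \<kappa> x z)
        + (\<Sum>x\<in>S. \<Sum>y\<in>S. c x * c y * \<kappa> x y)"
      unfolding eq by (simp add: sum.distrib sum_subtractf sum_distrib_left power2_eq_square sum_negf algebra_simps)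
    also have "\<dots> = (\<Sum>x\<in>S. \<Sum>y\<in>S. c x * c y * \<kappa> x y) - (t * \<kappa> z z) * (t * \<kappa> z z) / \<kappa> z z"
      unfolding t t' using pos by (simp add: power2_eq_square)
    also have "\<dots> = (\<Sum>x\<in>S. \<Sum>y\<in>S. c x * c y * (\<kappa> x y - \<kappa> x z * \<kappa> y z / \<kappa> z z))"
      unfolding t[symmetric]
      by (simp add: sum_product sum_divide_distrib sum_subtractf[symmetric] algebra_simps)
    finally show "0 \<le> (\<Sum>x\<in>S. \<Sum>y\<in>S. c x * c y * (\<kappa> x y - \<kappa> x z * \<kappa> y z / \<kappa> z z))" .
  qed
qed

lemma pd_scale:
  assumes "positive_definite_kernel \<kappa>"
  shows "positive_definite_kernel (\<lambda>x y. w x * w y * \<kappa> x y)"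
  unfolding positive_definite_kernel_def
proof (intro conjI allI impI)
  show "w x * w y * \<kappa> x y = w y * w x * \<kappa> y x" for x y
    using pd_sym[OF assms, of x y] by simp
  show "0 \<le> (\<Sum>x\<in>S. \<Sum>y\<in>S. c x * c y * (w x * w y * \<kappa> x y))" if "finite S" for S c
    using pd_indexed[OF assms that, of "\<lambda>x. c x * w x" id] by (simp add: mult_ac)
qed

text \<open>Peeling off one rank-one summand of \<open>\<kappa>\<close> per point reduces the Hadamard product to
  rescalings of \<open>\<kappa>'\<close>.\<close>

lemma pd_sum_mult_nonneg:
  assumes "finite S" "positive_definite_kernel \<kappa>" "positive_definite_kernel \<kappa>'"
  shows "0 \<le> (\<Sum>x\<in>S. \<Sum>y\<in>S. \<kappa> x y * \<kappa>' x y)"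
  using assms
proof (induction S arbitrary: \<kappa> rule: finite_induct)
  case empty
  then show ?case by simp
next
  case (insert z S)
  define l where "l x y = \<kappa> x y - \<kappa> x z * \<kappa> y z / \<kappa> z z" for x y
  \<comment> \<open>The remainder vanishes on the row and column of \<open>z\<close>, so its sums
    over \<open>S\<close> and over \<open>insert z S\<close> agree and the induction hypothesis
    applies.\<close>
  have l0: "l x z = 0" "l z x = 0" for x
    using pd_zero_diag[OF insert.prems(1), of z x] pd_sym[OF insert.prems(1), of x z]
    unfolding l_def by (cases "\<kappa> z z = 0"; simp)+
  have "0 \<le> (\<Sum>x\<in>S. \<Sum>y\<in>S. l x y * \<kappa>' x y)"
    using insert.IH[OF pd_schur_complement[OF insert.prems(1)] insert.prems(2)] unfolding l_def .
  also have "\<dots> = (\<Sum>x\<in>insert z S. \<Sum>y\<in>insert z S. l x y * \<kappa>' x y)"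
    using insert.hyps l0 by simp
  finally have a: "0 \<le> (\<Sum>x\<in>insert z S. \<Sum>y\<in>insert z S. l x y * \<kappa>' x y)" .
  have b: "0 \<le> (\<Sum>x\<in>insert z S. \<Sum>y\<in>insert z S. \<kappa> x z * \<kappa> y z * \<kappa>' x y) / \<kappa> z z"
    using pd_indexed[OF insert.prems(2), of "insert z S" "\<lambda>x. \<kappa> x z" id] insert.hyps pd_diag[OF insert.prems(1), of z]
    by simp
  have "(\<Sum>x\<in>insert z S. \<Sum>y\<in>insert z S. \<kappa> x y * \<kappa>' x y) =
      (\<Sum>x\<in>insert z S. \<Sum>y\<in>insert z S. l x y * \<kappa>' x y) +
      (\<Sum>x\<in>insert z S. \<Sum>y\<in>insert z S. \<kappa> x z * \<kappa> y z * \<kappa>' x y) / \<kappa> z z"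
    unfolding sum_divide_distrib sum.distrib[symmetric]
    by (intro sum.cong refl) (simp add: l_def algebra_simps)
  with a b show ?case by linarith
qed

lemma pd_mult:
  assumes "positive_definite_kernel \<kappa>" "positive_definite_kernel \<kappa>'"
  shows "positive_definite_kernel (\<lambda>x y. \<kappa> x y * \<kappa>' x y)"
  unfolding positive_definite_kernel_def
proof (intro conjI allI impI)
  show "\<kappa> x y * \<kappa>' x y = \<kappa> y x * \<kappa>' y x" for x y
    using pd_sym[OF assms(1), of x y] pd_sym[OF assms(2), of x y] by simp
  show "0 \<le> (\<Sum>x\<in>S. \<Sum>y\<in>S. c x * c y * (\<kappa> x y * \<kappa>' x y))" if "finite S" for S c
    using pd_sum_mult_nonneg[OF that pd_scale[OF assms(1), of c] assms(2)] by (simp add: mult_ac)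
qed

lemma pd_const:
  assumes "0 \<le> a"
  shows "positive_definite_kernel (\<lambda>x y. a)"
  unfolding positive_definite_kernel_def
proof (intro conjI allI impI)
  show "0 \<le> (\<Sum>x\<in>S. \<Sum>y\<in>S. c x * c y * a)" for S and c :: "'a \<Rightarrow> real"
    using assms by (simp flip: sum_distrib_right sum_product)
qed simp

lemma pd_add:
  assumes "positive_definite_kernel \<kappa>" "positive_definite_kernel \<kappa>'"
  shows "positive_definite_kernel (\<lambda>x y. \<kappa> x y + \<kappa>' x y)"
  using assms unfolding positive_definite_kernel_def
  by (simp add: distrib_left sum.distrib)

lemma pd_power:
  assumes "positive_definite_kernel \<kappa>"
  shows "positive_definite_kernel (\<lambda>x y. \<kappa> x y ^ n)"
  by (induction n) (simp_all add: pd_const pd_mult[OF assms])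

lemma pd_limit:
  assumes "\<And>n. positive_definite_kernel (f n)" "\<And>x y. (\<lambda>n. f n x y) \<longlonglongrightarrow> \<kappa> x y"
  shows "positive_definite_kernel \<kappa>"
  unfolding positive_definite_kernel_def
proof (intro conjI allI impI)
  show "\<kappa> x y = \<kappa> y x" for x y
    using assms(2)[of x y] assms(2)[of y x] pd_sym[OF assms(1), of _ x y]
    by (simp add: LIMSEQ_unique)
  show "0 \<le> (\<Sum>x\<in>S. \<Sum>y\<in>S. c x * c y * \<kappa> x y)" if "finite S" for S c
  proof (rule LIMSEQ_le_const)
    show "(\<lambda>n. \<Sum>x\<in>S. \<Sum>y\<in>S. c x * c y * f n x y) \<longlonglongrightarrow> (\<Sum>x\<in>S. \<Sum>y\<in>S. c x * c y * \<kappa> x y)"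
      by (intro tendsto_intros assms(2))
    show "\<exists>N. \<forall>n\<ge>N. 0 \<le> (\<Sum>x\<in>S. \<Sum>y\<in>S. c x * c y * f n x y)"
      using assms(1) that unfolding positive_definite_kernel_def by blast
  qed
qed

lemma pd_exp:
  assumes "positive_definite_kernel \<kappa>"
  shows "positive_definite_kernel (\<lambda>x y. exp (\<kappa> x y))"
proof (rule pd_limit)
  have "positive_definite_kernel (\<lambda>x y. 1 + (1 / real n) * \<kappa> x y)" for n
    using pd_add[OF pd_const[of 1] pd_mult[OF pd_const[of "1 / real n"] assms]] by simp
  then show "positive_definite_kernel (\<lambda>x y. (1 + (1 / real n) * \<kappa> x y) ^ n)" for n
    by (rule pd_power)
  show "(\<lambda>n. (1 + (1 / real n) * \<kappa> x y) ^ n) \<longlonglongrightarrow> exp (\<kappa> x y)" for x y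
    using tendsto_exp_limit_sequentially[of "\<kappa> x y"] by simp
qed

section \<open>Gaussian kernels of the squared distance\<close>

definition sq_dist :: "('v \<Rightarrow> 'v \<Rightarrow> real) \<Rightarrow> 'v \<Rightarrow> 'v \<Rightarrow> real" where
  "sq_dist \<kappa> x y = \<kappa> x x + \<kappa> y y - 2 * \<kappa> x y"

lemma sq_dist_nonneg: "positive_definite_kernel \<kappa> \<Longrightarrow> 0 \<le> sq_dist \<kappa> x y"
  using pd_pair[of \<kappa> 1 x "-1" y] by (simp add: sq_dist_def)

lemma sq_dist_self [simp]: "sq_dist \<kappa> x x = 0"
  by (simp add: sq_dist_def)

lemma sq_dist_commute: "positive_definite_kernel \<kappa> \<Longrightarrow> sq_dist \<kappa> x y = sq_dist \<kappa> y x"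
  unfolding sq_dist_def using pd_sym[of \<kappa> x y] by simp

text \<open>Expanding \<open>sq_dist\<close> shows the Gaussian to be an exponential kernel rescaled
  by \<open>exp (- t * \<kappa> x x)\<close>.\<close>

lemma pd_gaussian:
  assumes "positive_definite_kernel \<kappa>" "0 \<le> t"
  shows "positive_definite_kernel (\<lambda>x y. exp (- t * sq_dist \<kappa> x y))"
proof -
  have "positive_definite_kernel (\<lambda>x y. exp (- t * \<kappa> x x) * exp (- t * \<kappa> y y) * exp (2 * t * \<kappa> x y))"
    using assms by (intro pd_scale pd_exp pd_mult pd_const) auto
  also have "(\<lambda>x y. exp (- t * \<kappa> x x) * exp (- t * \<kappa> y y) * exp (2 * t * \<kappa> x y)) =
      (\<lambda>x y. exp (- t * sq_dist \<kappa> x y))"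
    by (intro ext) (simp add: sq_dist_def algebra_simps flip: exp_add)
  finally show ?thesis .
qed

text \<open>The kernel between the barycentres of lists of points in the reproducing kernel Hilbert
  space; the empty list represents the origin, since \<open>x / 0 = 0\<close>.\<close>

definition barycentre_kernel :: "('v \<Rightarrow> 'v \<Rightarrow> real) \<Rightarrow> 'v list \<Rightarrow> 'v list \<Rightarrow> real" where
  "barycentre_kernel \<kappa> xs ys =
     (\<Sum>i<length xs. \<Sum>j<length ys. \<kappa> (xs ! i) (ys ! j)) / (length xs * length ys)"

lemma pd_barycentre:
  assumes "positive_definite_kernel \<kappa>"
  shows "positive_definite_kernel (barycentre_kernel \<kappa>)"
  unfolding positive_definite_kernel_def
proof (intro conjI allI impI)
  show "barycentre_kernel \<kappa> xs ys = barycentre_kernel \<kappa> ys xs" for xs ys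
    unfolding barycentre_kernel_def
    by (subst sum.swap) (simp add: mult.commute pd_sym[OF assms, of "xs ! _"])
  fix S :: "'a list set" and c :: "'a list \<Rightarrow> real"
  assume S: "finite S"
  \<comment> \<open>Indices are positions in lists: the weight of a barycentre is spread evenly over
    its entries, which leaves a form in \<open>\<kappa>\<close>.\<close>
  let ?I = "SIGMA xs:S. {..<length xs}"
  have eq: "(\<Sum>(xs, i)\<in>?I. f xs i) = (\<Sum>xs\<in>S. \<Sum>i<length xs. f xs i)" for f :: "'a list \<Rightarrow> nat \<Rightarrow> real"
    using S by (subst sum.Sigma) auto
  have "0 \<le> (\<Sum>i\<in>?I. \<Sum>j\<in>?I. (case i of (xs, i) \<Rightarrow> c xs / length xs) *
      (case j of (xs, i) \<Rightarrow> c xs / length xs) * \<kappa> (case i of (xs, i) \<Rightarrow> xs ! i) (case j of (xs, i) \<Rightarrow> xs ! i))"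
    by (rule pd_indexed[OF assms]) (use S in auto)
  also have "\<dots> = (\<Sum>(xs, i)\<in>?I. \<Sum>(ys, j)\<in>?I. c xs / length xs * (c ys / length ys) * \<kappa> (xs ! i) (ys ! j))"
    by (simp add: split_beta)
  also have "\<dots> = (\<Sum>xs\<in>S. \<Sum>i<length xs. \<Sum>ys\<in>S. \<Sum>j<length ys.
      c xs / length xs * (c ys / length ys) * \<kappa> (xs ! i) (ys ! j))"
    unfolding eq ..
  also have "\<dots> = (\<Sum>xs\<in>S. \<Sum>ys\<in>S. \<Sum>i<length xs. \<Sum>j<length ys.
      c xs / length xs * (c ys / length ys) * \<kappa> (xs ! i) (ys ! j))"
    by (intro sum.cong refl sum.swap)
  also have "\<dots> = (\<Sum>xs\<in>S. \<Sum>ys\<in>S. c xs * c ys * barycentre_kernel \<kappa> xs ys)"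
    unfolding barycentre_kernel_def sum_divide_distrib sum_distrib_left by simp
  finally show "0 \<le> (\<Sum>xs\<in>S. \<Sum>ys\<in>S. c xs * c ys * barycentre_kernel \<kappa> xs ys)" .
qed

lemma barycentre_singleton: "barycentre_kernel \<kappa> [x] [y] = \<kappa> x y"
  by (simp add: barycentre_kernel_def)

lemma sq_dist_barycentre_singleton:
  "sq_dist (barycentre_kernel \<kappa>) [x] [y] = sq_dist \<kappa> x y"
  by (simp add: sq_dist_def barycentre_singleton)

text \<open>Huygens-Steiner identity: \<open>b\<close> is minus the sum of the squared distances of
  the entries from their barycentre. Since \<open>b\<close> is independent of \<open>x\<close>, it
  becomes a constant factor after exponentiation.\<close>

lemma sq_dist_barycentre:
  assumes "ys \<noteq> []"
  obtains b where "\<And>x. length ys * sq_dist (barycentre_kernel \<kappa>) [x] ys = (\<Sum>y\<leftarrow>ys. sq_dist \<kappa> x y) + b"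
proof
  fix x
  show "length ys * sq_dist (barycentre_kernel \<kappa>) [x] ys = (\<Sum>y\<leftarrow>ys. sq_dist \<kappa> x y) +
      (length ys * barycentre_kernel \<kappa> ys ys - (\<Sum>y\<leftarrow>ys. \<kappa> y y))"
    using assms by (simp add: sq_dist_def barycentre_kernel_def sum_list_addf sum_list_subtractf
        sum_list_triv sum_list_const_mult sum_list_sum_nth atLeast0LessThan algebra_simps
        sum.distrib sum_subtractf flip: sum_distrib_left)
qed

text \<open>Gram kernel of the vectors obtained by adding \<open>s\<close> times the image of
  \<open>h\<close> to \<open>g x\<close> times the image of \<open>f x\<close>, images being taken
  in the Hilbert space of \<open>R\<close>.\<close>

lemma pd_translate:
  assumes "positive_definite_kernel R"
  shows "positive_definite_kernel (\<lambda>x y. g x * g y * R (f x) (f y) + s * g x * R (f x) h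
    + s * g y * R (f y) h + s\<^sup>2 * R h h)"
  unfolding positive_definite_kernel_def
proof (intro conjI allI impI)
  show "g x * g y * R (f x) (f y) + s * g x * R (f x) h + s * g y * R (f y) h + s\<^sup>2 * R h h =
      g y * g x * R (f y) (f x) + s * g y * R (f y) h + s * g x * R (f x) h + s\<^sup>2 * R h h" for x y
    using pd_sym[OF assms, of "f x" "f y"] by simp
  fix S :: "'b set" and c :: "'b \<Rightarrow> real"
  assume S: "finite S"
  let ?I = "S \<times> UNIV"
  \<comment> \<open>Each \<open>x\<close> is used twice: with weight \<open>g x\<close> at
    \<open>f x\<close> and with weight \<open>s\<close> at \<open>h\<close>.\<close>
  let ?c = "\<lambda>(x, b). c x * (if b then g x else s)" and ?p = "\<lambda>(x, b). if b then f x else h"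
  have eq: "(\<Sum>i\<in>?I. F i) = (\<Sum>x\<in>S. F (x, True) + F (x, False))" for F :: "'b \<times> bool \<Rightarrow> real"
    by (subst sum.Sigma[OF S, symmetric, of "\<lambda>_. UNIV" "\<lambda>x b. F (x, b)", simplified]) (simp_all add: UNIV_bool add.commute)
  have sym: "R h (f y) = R (f y) h" for y
    by (rule pd_sym[OF assms])
  have "0 \<le> (\<Sum>i\<in>?I. \<Sum>j\<in>?I. ?c i * ?c j * R (?p i) (?p j))"
    by (rule pd_indexed[OF assms]) (use S in auto)
  also have "\<dots> = (\<Sum>x\<in>S. \<Sum>y\<in>S. c x * c y * (g x * g y * R (f x) (f y) + s * g x * R (f x) h
    + s * g y * R (f y) h + s\<^sup>2 * R h h))"
    unfolding eq sum.distrib[symmetric]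
    by (intro sum.cong refl) (simp add: algebra_simps power2_eq_square sym)
  finally show "0 \<le> (\<Sum>x\<in>S. \<Sum>y\<in>S. c x * c y * (g x * g y * R (f x) (f y) + s * g x * R (f x) h
    + s * g y * R (f y) h + s\<^sup>2 * R h h))" .
qed

subsection \<open>Integrals of positive definite kernels and Bernstein's formula\<close>

lemma pd_comp:
  assumes "positive_definite_kernel \<kappa>"
  shows "positive_definite_kernel (\<lambda>x y. \<kappa> (f x) (f y))"
  using pd_sym[OF assms] pd_indexed[OF assms] unfolding positive_definite_kernel_def by blast

text \<open>Points are chosen greedily so that the double sum of \<open>k\<close> over them never exceeds, up to the
  diagonal, the value expected for independent points.\<close>

lemma (in prob_space) pd_integral_nonneg:
  assumes pd: "positive_definite_kernel k"
    and k[measurable]: "case_prod k \<in> borel_measurable (M \<Otimes>\<^sub>M M)"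
    and B: "\<And>x y. \<bar>k x y\<bar> \<le> B"
  shows "0 \<le> (\<integral>x. \<integral>y. k x y \<partial>M \<partial>M)"
proof (rule ccontr)
  define J where "J x = (\<integral>y. k x y \<partial>M)" for x
  define I where "I = (\<integral>x. J x \<partial>M)"
  have J[measurable]: "J \<in> borel_measurable M" unfolding J_def by measurable
  have ik: "integrable M (k x)" if "x \<in> space M" for x
    using that by (intro integrable_const_bound[of _ B]) (auto simp: B)
  have JB: "\<bar>J x\<bar> \<le> B" if "x \<in> space M" for x
    using integral_le_const[OF ik[OF that], of B] integral_ge_const[OF ik[OF that], of "- B"] B[of x]
    unfolding J_def by (auto simp: abs_le_iff minus_le_iff)
  have iJ: "integrable M J"
    by (intro integrable_const_bound[of _ B]) (auto simp: JB)
  \<comment> \<open>Method of conditional expectations: with \<open>n\<close> points fixed and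
    \<open>N - n\<close> points still independent and random, the left side is the expected double
    sum without the diagonal terms of the random points. Each fixed diagonal term costs at most
    \<open>B\<close>.\<close>
  have greedy: "\<exists>p. (\<forall>i<n. p i \<in> space M) \<and>
      (\<Sum>i<n. \<Sum>j<n. k (p i) (p j)) + 2 * (real N - n) * (\<Sum>i<n. J (p i)) + (real N - n) * (real N - n - 1) * I
      \<le> real N * (real N - 1) * I + n * B" if "n \<le> N" for n N :: nat
    using that
  proof (induction n)
    case 0
    then show ?case by simp
  next
    case (Suc n)
    then obtain p where p: "\<And>i. i < n \<Longrightarrow> p i \<in> space M" and le:
      "(\<Sum>i<n. \<Sum>j<n. k (p i) (p j)) + 2 * (real N - n) * (\<Sum>i<n. J (p i)) + (real N - n) * (real N - n - 1) * I
      \<le> real N * (real N - 1) * I + n * B" by auto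
    define m where "m = real N - n - 1"
    \<comment> \<open>The part of the bound that depends on the new point; \<open>m\<close> counts
      the points left to draw after it. Some \<open>y\<close> does no worse than the mean of
      \<open>f\<close>.\<close>
    define f where "f y = 2 * (\<Sum>i<n. k (p i) y) + 2 * m * J y" for y
    have s_int: "integrable M (\<lambda>y. 2 * (\<Sum>i<n. k (p i) y))"
      by (intro integrable_mult_right Bochner_Integration.integrable_sum ik p) simp
    have s_val: "(\<integral>y. 2 * (\<Sum>i<n. k (p i) y) \<partial>M) = 2 * (\<Sum>i<n. J (p i))"
      unfolding J_def using p by (subst integral_mult_right_zero, subst Bochner_Integration.integral_sum) (auto intro: ik)
    have f_int: "integrable M f"
      unfolding f_def by (intro Bochner_Integration.integrable_add integrable_mult_right s_int iJ)
    have "(\<integral>y. f y \<partial>M) = 2 * (\<Sum>i<n. J (p i)) + 2 * m * I"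
      unfolding f_def s_val[symmetric] I_def
      by (subst Bochner_Integration.integral_add) (auto intro!: s_int ik p iJ)
    then have "\<exists>y\<in>space M. f y \<le> 2 * (\<Sum>i<n. J (p i)) + 2 * m * I"
      using expectation_greater[OF f_int, of "2 * (\<Sum>i<n. J (p i)) + 2 * m * I"]
      by (metis AE_I2 less_irrefl not_le)
    then obtain y where y: "y \<in> space M" "f y \<le> 2 * (\<Sum>i<n. J (p i)) + 2 * m * I" by blast
    let ?q = "p(n := y)"
    have e1: "(\<Sum>i<n. \<Sum>j<n. k (?q i) (?q j)) = (\<Sum>i<n. \<Sum>j<n. k (p i) (p j))"
      by (intro sum.cong) auto
    have e2: "(\<Sum>i<n. k (?q i) y) = (\<Sum>i<n. k (p i) y)"
      by (intro sum.cong) auto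
    then have e2': "(\<Sum>i<n. k y (?q i)) = (\<Sum>i<n. k (p i) y)"
      by (subst pd_sym[OF pd])
    have e3: "(\<Sum>i<n. J (?q i)) = (\<Sum>i<n. J (p i))" by (intro sum.cong) auto
    have "(\<Sum>i<Suc n. \<Sum>j<Suc n. k (?q i) (?q j)) =
        (\<Sum>i<n. \<Sum>j<n. k (p i) (p j)) + 2 * (\<Sum>i<n. k (p i) y) + k y y"
      using e1 e2 e2' by (simp add: sum.distrib)
    moreover have "(\<Sum>i<Suc n. J (?q i)) = (\<Sum>i<n. J (p i)) + J y"
      using e3 by simp
    moreover have "k y y \<le> B" using B[of y y] by simp
    ultimately have "(\<Sum>i<Suc n. \<Sum>j<Suc n. k (?q i) (?q j)) + 2 * m * (\<Sum>i<Suc n. J (?q i)) + m * (m - 1) * I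
      \<le> (\<Sum>i<n. \<Sum>j<n. k (p i) (p j)) + 2 * (m + 1) * (\<Sum>i<n. J (p i)) + (m + 1) * m * I + B"
      using y(2) unfolding f_def by (simp add: algebra_simps)
    also have "\<dots> \<le> real N * (real N - 1) * I + Suc n * B"
      using le unfolding m_def by (simp add: algebra_simps)
    finally have "(\<Sum>i<Suc n. \<Sum>j<Suc n. k (?q i) (?q j)) + 2 * (real N - Suc n) * (\<Sum>i<Suc n. J (?q i))
        + (real N - Suc n) * (real N - Suc n - 1) * I \<le> real N * (real N - 1) * I + Suc n * B"
      unfolding m_def by (simp add: algebra_simps)
    then show ?case using p y(1) by (intro exI[of _ ?q]) auto
  qed
  \<comment> \<open>With all \<open>N\<close> points fixed the left side is a Gram sum, hence
    nonnegative; dividing by \<open>N\<close> leaves a bound that fails for large \<open>N\<close>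
    if \<open>I\<close> is negative.\<close>
  have "0 \<le> (real N - 1) * I + B" if "0 < N" for N :: nat
  proof -
    obtain p where "(\<Sum>i<N. \<Sum>j<N. k (p i) (p j)) \<le> real N * (real N - 1) * I + N * B"
      using greedy[of N N] by auto
    moreover have "0 \<le> (\<Sum>i<N. \<Sum>j<N. k (p i) (p j))"
      using pd_indexed[OF pd, of "{..<N}" "\<lambda>_. 1" p] by simp
    ultimately have "0 \<le> real N * ((real N - 1) * I + B)" by (simp add: algebra_simps)
    then show ?thesis using that by (simp add: zero_le_mult_iff)
  qed
  note bound = this
  assume "\<not> 0 \<le> (\<integral>x. \<integral>y. k x y \<partial>M \<partial>M)"
  then have I: "I < 0" by (simp add: I_def J_def)
  obtain N :: nat where "B / (- I) < N" using reals_Archimedean2 by blast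
  then have "B < N * (- I)" using I by (simp add: field_simps)
  then show False using bound[of "Suc N"] by simp
qed

text \<open>The integrand of Bernstein's formula. At \<open>u = 0\<close> division by zero gives 0
  instead of the limit \<open>s\<close>, which affects a single point.\<close>

definition sqrt_density :: "real \<Rightarrow> real \<Rightarrow> real" where
  "sqrt_density s u = (1 - exp (- u\<^sup>2 * s)) / u\<^sup>2"

lemma sqrt_density_nonneg: "0 \<le> s \<Longrightarrow> 0 \<le> sqrt_density s u"
  unfolding sqrt_density_def by simp

lemma sqrt_density_measurable [measurable]:
  assumes "f \<in> borel_measurable N" "h \<in> borel_measurable N"
  shows "(\<lambda>x. sqrt_density (f x) (h x)) \<in> borel_measurable N"
  using assms unfolding sqrt_density_def by measurable

lemma integrable_sqrt_density_1: "integrable lborel (sqrt_density 1)"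
proof (rule Bochner_Integration.integrable_bound)
  show "integrable lborel (\<lambda>x::real. 2 * inverse (1 + x\<^sup>2))"
    using integrable_inverse_1_plus_square by (simp add: set_integrable_def)
  \<comment> \<open>The numerator is at most \<open>u\<^sup>2\<close> and at most 1; each bound
    serves one summand of \<open>1 + u\<^sup>2\<close>.\<close>
  have "sqrt_density 1 u \<le> 2 * inverse (1 + u\<^sup>2)" for u
  proof -
    have a: "1 - exp (- u\<^sup>2) \<le> u\<^sup>2" using exp_ge_add_one_self[of "- u\<^sup>2"] by simp
    have "(1 - exp (- u\<^sup>2)) * (1 + u\<^sup>2) = (1 - exp (- u\<^sup>2)) + (1 - exp (- u\<^sup>2)) * u\<^sup>2"
      by (simp add: algebra_simps)
    also have "\<dots> \<le> u\<^sup>2 + 1 * u\<^sup>2" using a by (intro add_mono mult_right_mono) auto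
    finally show ?thesis
      unfolding sqrt_density_def by (cases "u = 0") (auto simp: field_simps add_pos_nonneg)
  qed
  then show "AE u in lborel. norm (sqrt_density 1 u) \<le> norm (2 * inverse (1 + u\<^sup>2))"
    using sqrt_density_nonneg[of 1] by auto
qed measurable

text \<open>The form \<open>0 + sqrt s * u\<close> fits affine substitution in
  \<open>lborel\<close>, which costs a factor \<open>1 / sqrt s\<close> and leaves an integral
  proportional to \<open>sqrt s\<close>.\<close>

lemma sqrt_density_scale: "0 < s \<Longrightarrow> sqrt_density s u = s * sqrt_density 1 (0 + sqrt s * u)"
  unfolding sqrt_density_def by (simp add: power_mult_distrib mult.commute)

lemma integrable_sqrt_density: "0 \<le> s \<Longrightarrow> integrable lborel (sqrt_density s)"
proof (cases "s = 0")
  case False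
  assume "0 \<le> s"
  with False show ?thesis
    by (subst ext[of "sqrt_density s", OF sqrt_density_scale])
      (auto intro!: lborel_integrable_real_affine integrable_sqrt_density_1 simp del: add_0)
qed (simp add: sqrt_density_def[abs_def])

text \<open>In closed form this is \<open>2 * sqrt pi\<close>; it enters below through its
  positivity.\<close>

definition sqrt_const :: real where
  "sqrt_const = (\<integral>u. sqrt_density 1 u \<partial>lborel)"

lemma integral_sqrt_density: 
  assumes "0 \<le> s"
  shows "(\<integral>u. sqrt_density s u \<partial>lborel) = sqrt_const * sqrt s"
proof (cases "s = 0")
  case False
  with assms have s: "0 < s" by simp
  have "sqrt_const = sqrt s * (\<integral>u. sqrt_density 1 (0 + sqrt s * u) \<partial>lborel)"
    unfolding sqrt_const_def using s by (subst lborel_integral_real_affine[of "sqrt s" _ 0]) auto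
  then have "sqrt_const * sqrt s = s * (\<integral>u. sqrt_density 1 (0 + sqrt s * u) \<partial>lborel)"
    using s by (metis mult.assoc mult.commute real_sqrt_mult_self abs_of_pos)
  then show ?thesis by (subst ext[of "sqrt_density s", OF sqrt_density_scale[OF s]]) simp
qed (simp add: sqrt_density_def)

lemma sqrt_const_pos: "0 < sqrt_const"
proof -
  have "sqrt_const \<noteq> 0"
  proof
    assume "sqrt_const = 0"
    then have "AE u in lborel. sqrt_density 1 u = 0"
      unfolding sqrt_const_def using sqrt_density_nonneg[of 1]
      by (subst (asm) integral_nonneg_eq_0_iff_AE[OF integrable_sqrt_density_1]) auto
    moreover have "sqrt_density 1 u = 0 \<Longrightarrow> u = 0" for u
      by (auto simp: sqrt_density_def)
    ultimately have "AE u in lborel. u = (0::real)" by (auto elim: eventually_mono)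
    then have "AE u in lborel. u = (0::real) \<and> u \<noteq> 0"
      using AE_lborel_singleton[of "0::real"] by eventually_elim auto
    then show False by (simp add: ae_filter_eq_bot_iff flip: trivial_limit_def)
  qed
  moreover have "0 \<le> sqrt_const"
    unfolding sqrt_const_def using sqrt_density_nonneg[of 1] by (intro Bochner_Integration.integral_nonneg) auto
  ultimately show ?thesis by simp
qed

subsection \<open>Energy of a signed measure\<close>

text \<open>\<open>g\<close> is the density of a signed measure of total mass zero, to be pushed
  forward along \<open>X\<close>. The pointwise bounds give integrability over \<open>M\<close> and
  its square by comparison with constants.\<close>

locale kernel_energy = prob_space M for M :: "'a measure" +
  fixes X :: "'a \<Rightarrow> 'v::euclidean_space" and g :: "'a \<Rightarrow> real" and \<kappa> :: "'v \<Rightarrow> 'v \<Rightarrow> real"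
    and G C :: real
  assumes X_meas [measurable]: "X \<in> borel_measurable M"
    and g_meas [measurable]: "g \<in> borel_measurable M"
    and g_bound: "\<bar>g w\<bar> \<le> G"
    and g_mean: "(\<integral>w. g w \<partial>M) = 0"
    and pd: "positive_definite_kernel \<kappa>"
    and cont: "continuous_on UNIV (\<lambda>(x, y). \<kappa> x y)"
    and kernel_bound: "\<bar>\<kappa> x y\<bar> \<le> C"
begin

lemma continuous_kernel [continuous_intros]:
  assumes "continuous_on A f" "continuous_on A h"
  shows "continuous_on A (\<lambda>w. \<kappa> (f w) (h w))"
  using continuous_on_compose2[OF cont continuous_on_Pair[OF assms]] by simp

lemma kernel_measurable [measurable]:
  assumes [measurable]: "f \<in> borel_measurable N" "h \<in> borel_measurable N"
  shows "(\<lambda>w. \<kappa> (f w) (h w)) \<in> borel_measurable N"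
  by (rule borel_measurable_continuous_Pair[OF assms]) (use cont in \<open>simp add: split_beta'\<close>)

lemma sq_dist_measurable [measurable]:
  assumes [measurable]: "f \<in> borel_measurable N" "h \<in> borel_measurable N"
  shows "(\<lambda>w. sq_dist \<kappa> (f w) (h w)) \<in> borel_measurable N"
  unfolding sq_dist_def by measurable

lemma sum_sq_dist_measurable [measurable]:
  assumes [measurable]: "f \<in> borel_measurable N"
  shows "(\<lambda>w. \<Sum>y\<leftarrow>ys. sq_dist \<kappa> (f w) y) \<in> borel_measurable N"
  by (induction ys) auto

lemma continuous_sq_dist [continuous_intros]:
  assumes [continuous_intros]: "continuous_on A f" "continuous_on A h"
  shows "continuous_on A (\<lambda>w. sq_dist \<kappa> (f w) (h w))"
  unfolding sq_dist_def by (intro continuous_intros)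

lemma sq_dist_le: "sq_dist \<kappa> x y \<le> 4 * C"
  using kernel_bound[of x x] kernel_bound[of y y] kernel_bound[of x y] unfolding sq_dist_def by linarith

lemma G_nonneg: "0 \<le> G"
  using g_bound abs_ge_zero order_trans by blast

lemma gg_bound: "\<bar>g w * g w'\<bar> \<le> G * G"
  using g_bound G_nonneg by (simp add: abs_mult mult_mono)

lemma integrable_gg:
  assumes [measurable]: "case_prod f \<in> borel_measurable (M \<Otimes>\<^sub>M M)"
    and B: "\<And>w w'. \<bar>f w w'\<bar> \<le> B"
  shows "integrable (M \<Otimes>\<^sub>M M) (\<lambda>(w, w'). g w * g w' * f w w')"
proof -
  interpret MM: pair_prob_space M M ..
  have "\<bar>g w * g w' * f w w'\<bar> \<le> G * G * B" for w w'
    unfolding abs_mult[of "g w * g w'"] using gg_bound B abs_ge_zero by (intro mult_mono) auto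
  then show ?thesis
    by (intro MM.P.integrable_const_bound[of _ "G * G * B"]) auto
qed

definition energy :: "real \<Rightarrow> real" where
  "energy t = (\<integral>w. \<integral>w'. g w * g w' * exp (- t * sq_dist \<kappa> (X w) (X w')) \<partial>M \<partial>M)"

lemma gaussian_bound: "0 \<le> t \<Longrightarrow> \<bar>exp (- t * sq_dist \<kappa> x y)\<bar> \<le> 1"
  using sq_dist_nonneg[OF pd] by simp

lemma integrable_energy:
  assumes "0 \<le> t"
  shows "integrable (M \<Otimes>\<^sub>M M) (\<lambda>(w, w'). g w * g w' * exp (- t * sq_dist \<kappa> (X w) (X w')))"
  by (rule integrable_gg[of _ 1]) (use gaussian_bound[OF assms] in \<open>auto\<close>)

lemma energy_eq:
  assumes "0 \<le> t"
  shows "energy t = (\<integral>(w, w'). g w * g w' * exp (- t * sq_dist \<kappa> (X w) (X w')) \<partial>(M \<Otimes>\<^sub>M M))"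
proof -
  interpret MM: pair_prob_space M M ..
  show ?thesis unfolding energy_def by (rule MM.integral_fst[OF integrable_energy[OF assms]])
qed

lemma energy_nonneg:
  assumes "0 \<le> t"
  shows "0 \<le> energy t"
  unfolding energy_def
proof (rule pd_integral_nonneg)
  show "positive_definite_kernel (\<lambda>w w'. g w * g w' * exp (- t * sq_dist \<kappa> (X w) (X w')))"
    by (rule pd_scale[OF pd_comp[OF pd_gaussian[OF pd assms]]])
  show "\<bar>g w * g w' * exp (- t * sq_dist \<kappa> (X w) (X w'))\<bar> \<le> G * G" for w w'
    unfolding abs_mult[of "g w * g w'"]
    using mult_mono[OF gg_bound[of w w'] gaussian_bound[OF assms, of "X w" "X w'"]] G_nonneg by simp
qed measurable

lemma energy_0: "energy 0 = 0"
  unfolding energy_def by (simp add: g_mean)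

definition dist_energy :: real where
  "dist_energy = (\<integral>w. \<integral>w'. g w * g w' * kernel_dist \<kappa> (X w) (X w') \<partial>M \<partial>M)"

lemma kernel_dist_eq: "kernel_dist \<kappa> x y = sqrt (sq_dist \<kappa> x y)"
  by (simp add: kernel_dist_def sq_dist_def)

lemma kernel_dist_measurable [measurable]:
  assumes [measurable]: "f \<in> borel_measurable N" "h \<in> borel_measurable N"
  shows "(\<lambda>w. kernel_dist \<kappa> (f w) (h w)) \<in> borel_measurable N"
  unfolding kernel_dist_eq by measurable

lemma kernel_dist_bound: "\<bar>kernel_dist \<kappa> x y\<bar> \<le> sqrt (4 * C)"
  unfolding kernel_dist_eq using sq_dist_nonneg[OF pd, of x y] sq_dist_le[of x y] by simp

text \<open>Fubini for \<open>F\<close>: integrating over \<open>u\<close> first yields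
  \<open>sqrt_const\<close> times the weighted distance. Integrating over the sample points first
  yields \<open>- (energy (u\<^sup>2) / u\<^sup>2)\<close>, because the 1 in the numerator
  contributes the squared mean of \<open>g\<close>, which is 0.\<close>

lemma
  shows integrable_energy_density: "integrable lborel (\<lambda>u. energy (u\<^sup>2) / u\<^sup>2)"
    and dist_energy_eq: "sqrt_const * dist_energy = - (\<integral>u. energy (u\<^sup>2) / u\<^sup>2 \<partial>lborel)"
proof -
  interpret MM: pair_prob_space M M ..
  interpret P: pair_sigma_finite "M \<Otimes>\<^sub>M M" "lborel :: real measure" ..
  let ?\<delta> = "\<lambda>p. sq_dist \<kappa> (X (fst p)) (X (snd p))"
  define F where "F p u = g (fst p) * g (snd p) * sqrt_density (?\<delta> p) u" for p u
  have [measurable]: "case_prod F \<in> borel_measurable ((M \<Otimes>\<^sub>M M) \<Otimes>\<^sub>M lborel)"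
    unfolding F_def by measurable
  have \<delta>: "0 \<le> ?\<delta> p" for p by (rule sq_dist_nonneg[OF pd])
  have Fu: "integrable lborel (F p)" for p
    unfolding F_def by (intro integrable_mult_right integrable_sqrt_density \<delta>)
  have F: "integrable ((M \<Otimes>\<^sub>M M) \<Otimes>\<^sub>M lborel) (case_prod F)"
  proof (rule P.Fubini_integrable)
    have "(\<integral>u. norm (F p u) \<partial>lborel) = \<bar>g (fst p) * g (snd p)\<bar> * (sqrt_const * sqrt (?\<delta> p))" for p
      unfolding F_def integral_sqrt_density[OF \<delta>, symmetric]
      by (simp add: abs_mult sqrt_density_nonneg[OF \<delta>])
    moreover have "integrable (M \<Otimes>\<^sub>M M) (\<lambda>p. \<bar>g (fst p) * g (snd p) * kernel_dist \<kappa> (X (fst p)) (X (snd p))\<bar>)"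
      using integrable_gg[of "\<lambda>w w'. kernel_dist \<kappa> (X w) (X w')" "sqrt (4 * C)"] kernel_dist_bound
      by (intro integrable_abs) (simp add: split_beta')
    then have "integrable (M \<Otimes>\<^sub>M M) (\<lambda>p. sqrt_const * \<bar>g (fst p) * g (snd p) * kernel_dist \<kappa> (X (fst p)) (X (snd p))\<bar>)"
      by (rule integrable_mult_right)
    ultimately show "integrable (M \<Otimes>\<^sub>M M) (\<lambda>p. \<integral>u. norm (case (p, u) of (x, y) \<Rightarrow> F x y) \<partial>lborel)"
      by (simp add: kernel_dist_eq abs_mult \<delta> mult_ac)
  qed (use Fu in auto)
  have gg: "(\<integral>p. g (fst p) * g (snd p) \<partial>(M \<Otimes>\<^sub>M M)) = 0"
    using energy_eq[of 0] energy_0 by (simp add: split_beta')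
  have gg_int: "integrable (M \<Otimes>\<^sub>M M) (\<lambda>p. g (fst p) * g (snd p))"
    using integrable_energy[of 0] by (simp add: split_beta')
  have inner: "(\<integral>p. F p u \<partial>(M \<Otimes>\<^sub>M M)) = - (energy (u\<^sup>2) / u\<^sup>2)" for u
  proof -
    have e: "integrable (M \<Otimes>\<^sub>M M) (\<lambda>p. g (fst p) * g (snd p) * exp (- u\<^sup>2 * ?\<delta> p))"
      using integrable_energy[of "u\<^sup>2"] by (simp add: split_beta')
    have "(\<integral>p. F p u \<partial>(M \<Otimes>\<^sub>M M)) =
        (\<integral>p. (g (fst p) * g (snd p) - g (fst p) * g (snd p) * exp (- u\<^sup>2 * ?\<delta> p)) / u\<^sup>2 \<partial>(M \<Otimes>\<^sub>M M))"
      unfolding F_def sqrt_density_def by (simp add: algebra_simps)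
    also have "\<dots> = - energy (u\<^sup>2) / u\<^sup>2"
      using gg gg_int e energy_eq[of "u\<^sup>2"] by (simp add: split_beta')
    finally show ?thesis by simp
  qed
  from P.integrable_snd[OF F] show "integrable lborel (\<lambda>u. energy (u\<^sup>2) / u\<^sup>2)"
    unfolding inner by simp
  have "dist_energy = (\<integral>p. g (fst p) * g (snd p) * kernel_dist \<kappa> (X (fst p)) (X (snd p)) \<partial>(M \<Otimes>\<^sub>M M))"
    unfolding dist_energy_def
    by (subst MM.integral_fst[OF integrable_gg[OF _ kernel_dist_bound]]) (simp_all add: split_beta')
  moreover have Fp: "(\<integral>u. F p u \<partial>lborel) = sqrt_const * (g (fst p) * g (snd p) * kernel_dist \<kappa> (X (fst p)) (X (snd p)))" for p
    unfolding F_def integral_mult_right_zero integral_sqrt_density[OF \<delta>] kernel_dist_eq by simp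
  ultimately have "sqrt_const * dist_energy = (\<integral>p. (\<integral>u. F p u \<partial>lborel) \<partial>(M \<Otimes>\<^sub>M M))"
    by (simp add: Fp)
  also have "\<dots> = (\<integral>u. - (energy (u\<^sup>2) / u\<^sup>2) \<partial>lborel)"
    using P.Fubini_integral[OF F] unfolding inner by simp
  finally show "sqrt_const * dist_energy = - (\<integral>u. energy (u\<^sup>2) / u\<^sup>2 \<partial>lborel)" by simp
qed

lemma dist_energy_nonpos: "dist_energy \<le> 0"
proof -
  have "sqrt_const * dist_energy \<le> 0"
    unfolding dist_energy_eq by (simp add: energy_nonneg)
  then show ?thesis using sqrt_const_pos by (simp add: mult_le_0_iff)
qed

text \<open>A nonnegative integrand with integral 0 vanishes for almost every \<open>u\<close>. The
  zero set is closed by dominated convergence, and a closed set of full measure is the whole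
  line.\<close>

lemma energy_eq_0:
  assumes "dist_energy = 0"
  shows "energy (u\<^sup>2) = 0"
proof -
  have "(\<integral>u. energy (u\<^sup>2) / u\<^sup>2 \<partial>lborel) = 0"
    using assms dist_energy_eq by simp
  then have "AE u in lborel. energy (u\<^sup>2) / u\<^sup>2 = 0"
    by (subst (asm) integral_nonneg_eq_0_iff_AE[OF integrable_energy_density]) (auto simp: energy_nonneg)
  \<comment> \<open>At \<open>u = 0\<close> the quotient is 0 by convention and carries no
    information; \<open>energy_0\<close> covers that point.\<close>
  then have ae: "AE u in lebesgue. u \<in> {u. energy (u\<^sup>2) = 0}"
    by (intro AE_completion) (auto elim!: eventually_mono simp: energy_0)
  have closed: "closed {u. energy (u\<^sup>2) = 0}"
    unfolding closed_sequential_limits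
  proof (intro allI impI, elim conjE)
    fix v l assume v: "\<forall>n. v n \<in> {u. energy (u\<^sup>2) = 0}" and lim: "v \<longlonglongrightarrow> l"
    have "(\<lambda>n. energy ((v n)\<^sup>2)) \<longlonglongrightarrow> energy (l\<^sup>2)"
      unfolding energy_eq[OF zero_le_power2]
    proof (rule integral_dominated_convergence)
      show "AE p in M \<Otimes>\<^sub>M M. (\<lambda>n. case p of (w, w') \<Rightarrow> g w * g w' * exp (- (v n)\<^sup>2 * sq_dist \<kappa> (X w) (X w')))
          \<longlonglongrightarrow> (case p of (w, w') \<Rightarrow> g w * g w' * exp (- l\<^sup>2 * sq_dist \<kappa> (X w) (X w')))"
        by (auto intro!: tendsto_intros lim)
      interpret MM: pair_prob_space M M ..
      show "integrable (M \<Otimes>\<^sub>M M) (\<lambda>p. G * G :: real)" by simp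
      show "AE p in M \<Otimes>\<^sub>M M. norm (case p of (w, w') \<Rightarrow> g w * g w' * exp (- (v n)\<^sup>2 * sq_dist \<kappa> (X w) (X w'))) \<le> G * G" for n
      proof (rule AE_I2, clarify)
        fix w w'
        show "norm (g w * g w' * exp (- (v n)\<^sup>2 * sq_dist \<kappa> (X w) (X w'))) \<le> G * G"
          unfolding real_norm_def abs_mult[of "g w * g w'"]
          using mult_mono[OF gg_bound[of w w'] gaussian_bound[of "(v n)\<^sup>2" "X w" "X w'"]] G_nonneg by simp
      qed
    qed measurable
    with v show "l \<in> {u. energy (u\<^sup>2) = 0}"
      by (simp add: LIMSEQ_const_iff)
  qed
  show ?thesis
    using mem_closed_if_AE_lebesgue_open[OF open_UNIV closed, of u] ae by simp
qed

text \<open>Add \<open>s\<close> times the image of the barycentre of \<open>ys\<close> to the embedded signed measure: the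
  energy becomes \<open>energy t + 2 * s * J + s\<^sup>2\<close> with \<open>J\<close> proportional to the integral below. It is
  nonnegative for all \<open>s\<close> and \<open>energy t = 0\<close>, so \<open>J = 0\<close>.\<close>

lemma gaussian_test_eq_0:
  assumes "dist_energy = 0"
  shows "(\<integral>w. g w * exp (- (\<Sum>y\<leftarrow>ys. sq_dist \<kappa> (X w) y)) \<partial>M) = 0"
proof (cases "ys = []")
  case True
  then show ?thesis using g_mean by simp
next
  case False
  \<comment> \<open>This width makes \<open>R [x] ys\<close> a product of Gaussians with unit
    exponents, up to the factor \<open>exp (- b)\<close>. It is tied to the fixed list, not to the
    argument named \<open>ys\<close> in \<open>R\<close>.\<close>
  let ?t = "real (length ys)" and ?b = "barycentre_kernel \<kappa>"
  define R where "R xs ys = exp (- ?t * sq_dist ?b xs ys)" for xs ys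
  have R: "positive_definite_kernel R"
    unfolding R_def by (rule pd_gaussian[OF pd_barycentre[OF pd]]) simp
  have R_le: "\<bar>R xs zs\<bar> \<le> 1" for xs zs
    unfolding R_def using sq_dist_nonneg[OF pd_barycentre[OF pd], of xs zs] by simp
  have R_self [simp]: "R zs zs = 1" for zs
    unfolding R_def by simp
  obtain b where b: "\<And>x. ?t * sq_dist ?b [x] ys = (\<Sum>y\<leftarrow>ys. sq_dist \<kappa> x y) + b"
    using sq_dist_barycentre[OF False] by blast
  have R1: "R [x] ys = exp (- (\<Sum>y\<leftarrow>ys. sq_dist \<kappa> x y)) * exp (- b)" for x
    unfolding R_def mult_minus_left b by (simp flip: exp_add)
  have R2: "R [x] [y] = exp (- ?t * sq_dist \<kappa> x y)" for x y
    unfolding R_def sq_dist_barycentre_singleton ..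
  have [measurable]: "(\<lambda>w. R [X w] ys) \<in> borel_measurable M"
    unfolding R1 by measurable
  have [measurable]: "case_prod (\<lambda>w w'. R [X w] [X w']) \<in> borel_measurable (M \<Otimes>\<^sub>M M)"
    unfolding R2 by measurable
  define J where "J = (\<integral>w. g w * R [X w] ys \<partial>M)"
  define k where "k s w w' = g w * g w' * R [X w] [X w'] + s * g w * R [X w] ys
      + s * g w' * R [X w'] ys + s\<^sup>2 * R ys ys" for s w w'
  have gR: "\<bar>g w * R zs zs'\<bar> \<le> G" for w zs zs'
    using mult_mono[OF g_bound[of w] R_le[of zs zs']] G_nonneg by (simp add: abs_mult)
  have gR_int: "integrable M (\<lambda>w. g w * R [X w] ys)"
    using gR by (intro integrable_const_bound[of _ G]) auto
  have "0 \<le> 2 * s * J + s\<^sup>2" for s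
  proof -
    have "0 \<le> (\<integral>w. \<integral>w'. k s w w' \<partial>M \<partial>M)"
    proof (rule pd_integral_nonneg)
      show "positive_definite_kernel (k s)"
        unfolding k_def by (rule pd_translate[OF R])
      show "case_prod (k s) \<in> borel_measurable (M \<Otimes>\<^sub>M M)"
        unfolding k_def by measurable
      show "\<bar>k s w w'\<bar> \<le> G * G + \<bar>s\<bar> * G + \<bar>s\<bar> * G + s\<^sup>2" for w w'
      proof -
        have "\<bar>g w * (g w' * R [X w] [X w'])\<bar> \<le> G * G"
          unfolding abs_mult[of "g w"] using g_bound gR G_nonneg by (intro mult_mono) auto
        moreover have "\<bar>s * (g v * R [X v] ys)\<bar> \<le> \<bar>s\<bar> * G" for v
          unfolding abs_mult[of s] using gR by (intro mult_left_mono) auto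
        from this[of w] this[of w'] calculation zero_le_power2[of s] show ?thesis
          unfolding k_def mult.assoc R_self abs_le_iff by linarith
      qed
    qed
    also have "(\<integral>w. \<integral>w'. k s w w' \<partial>M \<partial>M) = energy ?t + 2 * s * J + s\<^sup>2"
    proof -
      have i1: "integrable M (\<lambda>w'. g w * g w' * R [X w] [X w'])" if "w \<in> space M" for w
        using gR[of w] G_nonneg that R_le gg_bound
        by (intro integrable_const_bound[of _ "G * G * 1"]) (auto simp: abs_mult[of "g w * g _"] intro!: AE_I2 mult_mono simp del: mult_1_right)
      have "(\<integral>w'. k s w w' \<partial>M) = (\<integral>w'. g w * g w' * R [X w] [X w'] \<partial>M) + s * (g w * R [X w] ys) + s * J + s\<^sup>2"
        if "w \<in> space M" for w
        unfolding k_def J_def mult.assoc[of s] using i1[OF that] gR_int by (simp add: prob_space)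
      then have "(\<integral>w. \<integral>w'. k s w w' \<partial>M \<partial>M) = (\<integral>w. (\<integral>w'. g w * g w' * R [X w] [X w'] \<partial>M) + s * (g w * R [X w] ys) + s * J + s\<^sup>2 \<partial>M)"
        by (intro Bochner_Integration.integral_cong) auto
      also have "\<dots> = energy ?t + s * J + s * J + s\<^sup>2"
      proof -
        interpret MM: pair_prob_space M M ..
        have "integrable M (\<lambda>w. \<integral>w'. g w * g w' * R [X w] [X w'] \<partial>M)"
          unfolding R2 by (rule MM.integrable_fst[OF integrable_energy]) simp
        then show ?thesis
          using gR_int unfolding energy_def J_def R2 by (simp add: prob_space)
      qed
      finally show ?thesis by simp
    qed
    also have "energy ?t = 0"
      using energy_eq_0[OF assms, of "sqrt ?t"] by simp
    finally show ?thesis by simp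
  qed
  \<comment> \<open>At \<open>s = - J\<close> the inequality reads
    \<open>0 \<le> - J\<^sup>2\<close>.\<close>
  from this[of "- J"] have "J = 0" by (auto simp: power2_eq_square mult_le_0_iff)
  then show ?thesis unfolding J_def R1 by (simp flip: mult.assoc)
qed

subsection \<open>Vanishing energy\<close>

text \<open>Quantifying over all lists of centres builds in stability under multiplication by
  further Gaussians; boundedness and measurability serve dominated convergence.\<close>

definition annihilated :: "('v \<Rightarrow> real) \<Rightarrow> bool" where
  "annihilated H \<longleftrightarrow> H \<in> borel_measurable borel \<and> (\<exists>b. \<forall>x. \<bar>H x\<bar> \<le> b) \<and>
     (\<forall>ys. (\<integral>w. g w * (H (X w) * exp (- (\<Sum>y\<leftarrow>ys. sq_dist \<kappa> (X w) y))) \<partial>M) = 0)"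

lemma annihilated_measurable: "annihilated H \<Longrightarrow> H \<in> borel_measurable borel"
  by (simp add: annihilated_def)

lemma sum_sq_dist_nonneg: "0 \<le> (\<Sum>y\<leftarrow>ys. sq_dist \<kappa> x y)"
  by (intro sum_list_nonneg) (auto simp: sq_dist_nonneg[OF pd])

lemma test_bound:
  assumes "\<bar>h\<bar> \<le> b"
  shows "\<bar>g w * (h * exp (- (\<Sum>y\<leftarrow>ys. sq_dist \<kappa> x y)))\<bar> \<le> G * b"
proof -
  have "\<bar>h * exp (- (\<Sum>y\<leftarrow>ys. sq_dist \<kappa> x y))\<bar> \<le> b * 1"
    unfolding abs_mult using assms sum_sq_dist_nonneg[of x ys] by (intro mult_mono) auto
  then show ?thesis
    unfolding abs_mult[of "g w"] using g_bound G_nonneg by (intro mult_mono) auto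
qed

lemma annihilated_integrable:
  assumes "annihilated H"
  shows "integrable M (\<lambda>w. g w * (H (X w) * exp (- (\<Sum>y\<leftarrow>ys. sq_dist \<kappa> (X w) y))))"
proof -
  obtain b where b: "\<And>x. \<bar>H x\<bar> \<le> b" and [measurable]: "H \<in> borel_measurable borel"
    using assms unfolding annihilated_def by blast
  show ?thesis
    by (rule integrable_const_bound[of _ "G * b"]) (use test_bound[OF b] in auto)
qed

lemma annihilated_combine:
  assumes "annihilated H" "annihilated H'"
  shows "annihilated (\<lambda>x. a * H x + a' * H' x)"
proof -
  obtain b b' where b: "\<And>x. \<bar>H x\<bar> \<le> b" "\<And>x. \<bar>H' x\<bar> \<le> b'"
    using assms unfolding annihilated_def by blast
  have [measurable]: "H \<in> borel_measurable borel" "H' \<in> borel_measurable borel"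
    using assms by (simp_all add: annihilated_measurable)
  have "\<bar>a * H x + a' * H' x\<bar> \<le> \<bar>a\<bar> * b + \<bar>a'\<bar> * b'" for x
    by (rule order_trans[OF abs_triangle_ineq]) (auto simp: abs_mult intro!: add_mono mult_left_mono b)
  moreover have "(\<integral>w. g w * ((a * H (X w) + a' * H' (X w)) * exp (- (\<Sum>y\<leftarrow>ys. sq_dist \<kappa> (X w) y))) \<partial>M) = 0" for ys
  proof -
    have "(\<integral>w. g w * ((a * H (X w) + a' * H' (X w)) * exp (- (\<Sum>y\<leftarrow>ys. sq_dist \<kappa> (X w) y))) \<partial>M)
      = (\<integral>w. a * (g w * (H (X w) * exp (- (\<Sum>y\<leftarrow>ys. sq_dist \<kappa> (X w) y)))) +
          a' * (g w * (H' (X w) * exp (- (\<Sum>y\<leftarrow>ys. sq_dist \<kappa> (X w) y)))) \<partial>M)"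
      by (intro Bochner_Integration.integral_cong refl) (simp add: algebra_simps)
    also have "\<dots> = 0"
      using assms annihilated_integrable[OF assms(1)] annihilated_integrable[OF assms(2)]
      by (simp add: annihilated_def)
    finally show ?thesis .
  qed
  ultimately show ?thesis unfolding annihilated_def by (auto intro!: exI)
qed

lemma annihilated_exp:
  assumes "annihilated H"
  shows "annihilated (\<lambda>x. H x * exp (- sq_dist \<kappa> x z))"
proof -
  obtain b where b: "\<And>x. \<bar>H x\<bar> \<le> b" and [measurable]: "H \<in> borel_measurable borel"
    using assms unfolding annihilated_def by blast
  have "\<bar>H x * exp (- sq_dist \<kappa> x z)\<bar> \<le> b * 1" for x
    unfolding abs_mult using sq_dist_nonneg[OF pd, of x z] b[of x] by (intro mult_mono) auto
  moreover have "(\<integral>w. g w * (H (X w) * exp (- sq_dist \<kappa> (X w) z) * exp (- (\<Sum>y\<leftarrow>ys. sq_dist \<kappa> (X w) y))) \<partial>M) = 0" for ys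
  proof -
    have eq: "H x * exp (- sq_dist \<kappa> x z) * exp (- (\<Sum>y\<leftarrow>ys. sq_dist \<kappa> x y)) =
        H x * exp (- (\<Sum>y\<leftarrow>z # ys. sq_dist \<kappa> x y))" for x
      by (simp add: mult.assoc flip: exp_add)
    show ?thesis using assms unfolding eq annihilated_def by blast
  qed
  ultimately show ?thesis unfolding annihilated_def by (auto intro!: exI)
qed

lemma annihilated_limit:
  assumes H: "\<And>n. annihilated (H n)" and b: "\<And>n x. \<bar>H n x\<bar> \<le> b" and lim: "\<And>x. (\<lambda>n. H n x) \<longlonglongrightarrow> H' x"
  shows "annihilated H'"
proof -
  have [measurable]: "H n \<in> borel_measurable borel" for n
    using H by (rule annihilated_measurable)
  have [measurable]: "H' \<in> borel_measurable borel"
    by (rule borel_measurable_LIMSEQ_real[OF lim]) measurable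
  have "\<bar>H' x\<bar> \<le> b" for x
    by (rule LIMSEQ_le_const2[OF tendsto_rabs[OF lim]]) (use b in auto)
  moreover have "(\<integral>w. g w * (H' (X w) * exp (- (\<Sum>y\<leftarrow>ys. sq_dist \<kappa> (X w) y))) \<partial>M) = 0" for ys
  proof -
    have "(\<lambda>n. \<integral>w. g w * (H n (X w) * exp (- (\<Sum>y\<leftarrow>ys. sq_dist \<kappa> (X w) y))) \<partial>M) \<longlonglongrightarrow>
        (\<integral>w. g w * (H' (X w) * exp (- (\<Sum>y\<leftarrow>ys. sq_dist \<kappa> (X w) y))) \<partial>M)"
      by (rule integral_dominated_convergence[where w="\<lambda>_. G * b"])
        (use test_bound[OF b] in \<open>auto intro!: tendsto_intros lim\<close>)
    then show ?thesis using H unfolding annihilated_def by (simp add: LIMSEQ_const_iff)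
  qed
  ultimately show ?thesis unfolding annihilated_def by (auto intro!: exI)
qed

lemma annihilated_0: "annihilated (\<lambda>x. 0)"
  by (auto simp: annihilated_def)

lemma annihilated_sum:
  assumes "\<And>i. i \<in> I \<Longrightarrow> annihilated (H i)"
  shows "annihilated (\<lambda>x. \<Sum>i\<in>I. H i x)"
  using assms
proof (induction I rule: infinite_finite_induct)
  case (insert i I)
  then show ?case using annihilated_combine[of "H i" _ 1 1] by simp
qed (simp_all add: annihilated_0)

text \<open>With \<open>m + n\<close> fixed and up to binomial coefficients, the factors of
  \<open>H\<close> are Bernstein polynomials in the Gaussian. A factor of the second kind is a
  difference of two annihilated functions.\<close>

lemma annihilated_power:
  assumes "annihilated H"
  shows "annihilated (\<lambda>x. H x * (exp (- sq_dist \<kappa> x z) ^ m * (1 - exp (- sq_dist \<kappa> x z)) ^ n))"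
proof -
  have *: "annihilated (\<lambda>x. H x * exp (- sq_dist \<kappa> x z) ^ m)"
  proof (induction m)
    case (Suc m)
    show ?case using annihilated_exp[OF Suc, of z]
      by (simp add: power_Suc2 mult.assoc del: power_Suc)
  qed (simp add: assms)
  show ?thesis
  proof (induction n)
    case 0
    then show ?case using * by simp
  next
    case (Suc n)
    then show ?case
      using annihilated_combine[OF Suc annihilated_exp[OF Suc, of z], of 1 "- 1"]
      by (simp add: algebra_simps)
  qed
qed

lemma annihilated_continuous:
  assumes H: "annihilated H" and f: "continuous_on {0..1} f"
  shows "annihilated (\<lambda>x. H x * f (exp (- sq_dist \<kappa> x z)))"
proof -
  let ?e = "\<lambda>x. exp (- sq_dist \<kappa> x z)"
  have e: "?e x \<in> {0..1}" for x
    using sq_dist_nonneg[OF pd, of x z] by simp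
  obtain b where b: "\<And>x. \<bar>H x\<bar> \<le> b"
    using H unfolding annihilated_def by blast
  have "bounded (f ` {0..1})"
    by (intro compact_imp_bounded compact_continuous_image f) simp
  then obtain c where "\<forall>s\<in>{0..1}. \<bar>f s\<bar> \<le> c"
    unfolding bounded_iff by auto
  then have c: "\<And>s. s \<in> {0..1} \<Longrightarrow> \<bar>f s\<bar> \<le> c"
    by blast
  have "\<exists>n. \<forall>s\<in>{0..1}. \<bar>f s - (\<Sum>k\<le>n. f (k / n) * Bernstein n k s)\<bar> < 1 / Suc m" for m
  proof -
    have "0 < 1 / real (Suc m)" by simp
    from Bernstein_Weierstrass[OF f this] show ?thesis by blast
  qed
  then obtain N where N: "\<And>m s. s \<in> {0..1} \<Longrightarrow>
      \<bar>f s - (\<Sum>k\<le>N m. f (k / N m) * Bernstein (N m) k s)\<bar> < 1 / Suc m"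
    by metis
  define P where "P m s = (\<Sum>k\<le>N m. f (k / N m) * Bernstein (N m) k s)" for m s
  have P: "\<bar>f s - P m s\<bar> < 1 / Suc m" if "s \<in> {0..1}" for m s
    using N[OF that] unfolding P_def .
  have "annihilated (\<lambda>x. H x * P m (?e x))" for m
  proof -
    \<comment> \<open>The summand \<open>0 * 0\<close> gives the scalar multiple the shape of
      \<open>annihilated_combine\<close>.\<close>
    have "annihilated (\<lambda>x. \<Sum>k\<le>N m. (f (k / N m) * (N m choose k)) *
        (H x * (?e x ^ k * (1 - ?e x) ^ (N m - k))) + 0 * 0)"
      by (intro annihilated_sum annihilated_combine annihilated_power H annihilated_0)
    then show ?thesis unfolding P_def Bernstein_def by (simp add: sum_distrib_left mult_ac)
  qed
  then show ?thesis
  proof (rule annihilated_limit)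
    show "\<bar>H x * P m (?e x)\<bar> \<le> b * (c + 1)" for m x
    proof -
      have "1 / real (Suc m) \<le> 1" by simp
      with P[OF e, of x m] c[OF e, of x] have "\<bar>P m (?e x)\<bar> \<le> c + 1" by linarith
      with b[of x] show ?thesis unfolding abs_mult by (intro mult_mono) auto
    qed
    have "(\<lambda>m. P m (?e x)) \<longlonglongrightarrow> f (?e x)" for x
    proof (rule metric_LIMSEQ_I)
      fix r :: real assume "0 < r"
      then obtain n where n: "1 / real (Suc n) < r" using nat_approx_posE by blast
      have "dist (P m (?e x)) (f (?e x)) < r" if "n \<le> m" for m
      proof -
        have "1 / real (Suc m) \<le> 1 / real (Suc n)" using that by (simp add: frac_le)
        with P[OF e, of x m] n show ?thesis by (simp add: dist_real_def)
      qed
      then show "\<exists>no. \<forall>m\<ge>no. dist (P m (?e x)) (f (?e x)) < r" by blast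
    qed
    then show "(\<lambda>m. H x * P m (?e x)) \<longlonglongrightarrow> H x * f (?e x)" for x
      by (intro tendsto_intros)
  qed
qed

text \<open>For \<open>0 < r \<le> 1\<close> the superlevel set is a closed ball of the kernel
  metric about \<open>z\<close>, so intersections of balls are reached one centre at a time.\<close>

lemma annihilated_superlevel:
  assumes H: "annihilated H"
  shows "annihilated (\<lambda>x. H x * indicator {x. r \<le> exp (- sq_dist \<kappa> x z)} x)"
proof -
  obtain b where b: "\<And>x. \<bar>H x\<bar> \<le> b"
    using H unfolding annihilated_def by blast
  show ?thesis
  proof (rule annihilated_limit)
    \<comment> \<open>For positive \<open>n\<close>, a ramp that is 1 for \<open>s \<ge> r\<close>
      and 0 for \<open>s \<le> r - 1 / n\<close>, so the limit keeps the boundary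
      \<open>s = r\<close>.\<close>
    let ?f = "\<lambda>n s. max 0 (min 1 (1 + real n * (s - r)))"
    show "annihilated (\<lambda>x. H x * ?f n (exp (- sq_dist \<kappa> x z)))" for n
      by (intro annihilated_continuous H continuous_intros)
    show "\<bar>H x * ?f n (exp (- sq_dist \<kappa> x z))\<bar> \<le> b * 1" for n x
      unfolding abs_mult using b[of x] by (intro mult_mono) auto
    have "(\<lambda>n. ?f n s) \<longlonglongrightarrow> (if r \<le> s then 1 else 0)" for s
    proof (cases "r \<le> s")
      case True
      then have "?f n s = 1" for n by simp
      then show ?thesis using True by simp
    next
      case False
      then obtain n where n: "1 / (r - s) < real n" using reals_Archimedean2 by blast
      have "?f m s = 0" if "n \<le> m" for m
      proof -
        have "1 < real n * (r - s)" using n False by (simp add: field_simps)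
        also have "\<dots> \<le> real m * (r - s)" using that False by (intro mult_right_mono) auto
        finally show ?thesis by (simp add: algebra_simps)
      qed
      then have "\<forall>\<^sub>F m in sequentially. ?f m s = 0"
        by (rule eventually_sequentiallyI)
      then show ?thesis using False by (simp add: tendsto_eventually)
    qed
    from tendsto_mult_left[OF this, of "H _" "exp (- sq_dist \<kappa> _ z)"]
    show "(\<lambda>n. H x * ?f n (exp (- sq_dist \<kappa> x z))) \<longlonglongrightarrow> H x * indicator {x. r \<le> exp (- sq_dist \<kappa> x z)} x" for x
      by (simp add: indicator_def of_bool_def)
  qed
qed

text \<open>Finite intersections of closed balls, the radius being encoded by the level
  \<open>r\<close>. The empty list gives the whole space, and appending lists intersects
  cells.\<close>

definition cell :: "('v \<times> real) list \<Rightarrow> 'v set" where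
  "cell l = {x. \<forall>(z, r)\<in>set l. r \<le> exp (- sq_dist \<kappa> x z)}"

lemma annihilated_cell:
  assumes "dist_energy = 0"
  shows "annihilated (indicator (cell l))"
proof (induction l)
  case Nil
  then show ?case
    using gaussian_test_eq_0[OF assms] by (auto simp: annihilated_def cell_def)
next
  case (Cons p l)
  obtain z r where p: "p = (z, r)" by force
  have "(\<lambda>x. indicator (cell l) x * indicator {x. r \<le> exp (- sq_dist \<kappa> x z)} x) = (indicator (cell (p # l)) :: 'v \<Rightarrow> real)"
    by (auto simp: cell_def p indicator_def)
  then show ?case using annihilated_superlevel[OF Cons, of r z] by simp
qed

section \<open>Cells generate the Borel sets\<close>

lemma Int_stable_cells: "Int_stable (range cell)"
proof (rule Int_stableI)
  fix A B assume "A \<in> range cell" "B \<in> range cell"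
  then obtain k l where "A = cell k" "B = cell l" by blast
  then have "A \<inter> B = cell (k @ l)" by (auto simp: cell_def)
  then show "A \<inter> B \<in> range cell" by blast
qed

text \<open>A compact set is recovered from finite covers by balls of radii \<open>1 / n\<close> centred in it; the
  topology of the kernel metric may be coarser than the Euclidean one, so opens are not
  directly accessible.\<close>

lemma compact_in_sigma_cells:
  assumes sep: "\<And>x y. sq_dist \<kappa> x y = 0 \<Longrightarrow> x = y" and K: "compact K"
  shows "K \<in> sigma_sets UNIV (range cell)"
proof -
  let ?S = "sigma_sets UNIV (range cell)"
  interpret S: sigma_algebra UNIV ?S by (rule sigma_algebra_sigma_sets) simp
  have "\<exists>T. finite T \<and> T \<subseteq> K \<and> K \<subseteq> (\<Union>z\<in>T. {x. sq_dist \<kappa> x z < 1 / Suc n})" for n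
  proof -
    have op: "open {x. sq_dist \<kappa> x z < 1 / Suc n}" for z
      by (intro open_Collect_less continuous_intros)
    have "K \<subseteq> (\<Union>z\<in>K. {x. sq_dist \<kappa> x z < 1 / Suc n})" by force
    from compactE_image[OF K op this] show ?thesis by metis
  qed
  then obtain T where T: "\<And>n. finite (T n)" "\<And>n. T n \<subseteq> K"
      "\<And>n. K \<subseteq> (\<Union>z\<in>T n. {x. sq_dist \<kappa> x z < 1 / Suc n})"
    by metis
  have "K = (\<Inter>n. \<Union>z\<in>T n. cell [(z, exp (- (1 / Suc n)))])"
  proof (intro equalityI subsetI)
    fix x assume "x \<in> K"
    then show "x \<in> (\<Inter>n. \<Union>z\<in>T n. cell [(z, exp (- (1 / Suc n)))])"
      using T(3) by (fastforce simp: cell_def intro: less_imp_le)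
  next
    fix x assume x: "x \<in> (\<Inter>n. \<Union>z\<in>T n. cell [(z, exp (- (1 / Suc n)))])"
    have near: "\<exists>z\<in>K. sq_dist \<kappa> x z \<le> 1 / Suc n" for n
      using x T(2)[of n] by (fastforce simp: cell_def)
    then have "K \<noteq> {}" by blast
    \<comment> \<open>By compactness \<open>x\<close> has a nearest point in \<open>K\<close>; lying
      in all the covers forces that distance to be 0, and \<open>sep\<close> identifies the two
      points.\<close>
    then obtain z where z: "z \<in> K" "\<And>y. y \<in> K \<Longrightarrow> sq_dist \<kappa> x z \<le> sq_dist \<kappa> x y"
      using continuous_attains_inf[OF K, of "sq_dist \<kappa> x"]
        continuous_sq_dist[of K "\<lambda>_. x" "\<lambda>y. y"] by (auto simp: continuous_on_const continuous_on_id)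
    have "sq_dist \<kappa> x z \<le> 0"
    proof (rule ccontr)
      assume "\<not> sq_dist \<kappa> x z \<le> 0"
      then obtain n where "1 / real (Suc n) < sq_dist \<kappa> x z"
        using nat_approx_posE[of "sq_dist \<kappa> x z"] by auto
      with near[of n] z(2) show False by force
    qed
    with sq_dist_nonneg[OF pd, of x z] sep[of x z] z(1) show "x \<in> K" by simp
  qed
  also have "\<dots> \<in> ?S"
    by (intro S.countable_INT image_subsetI S.finite_UN T sigma_sets.Basic) auto
  finally show ?thesis .
qed

text \<open>Closed sets are countable unions of compact ones; conversely, continuity of the kernel
  makes cells closed.\<close>

lemma borel_eq_sigma_cells:
  assumes sep: "\<And>x y. sq_dist \<kappa> x y = 0 \<Longrightarrow> x = y"
  shows "sets borel = sigma_sets UNIV (range cell)"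
proof (intro equalityI)
  interpret S: sigma_algebra UNIV "sigma_sets UNIV (range cell)"
    by (rule sigma_algebra_sigma_sets) simp
  have "S \<in> sigma_sets UNIV (range cell)" if "closed S" for S
  proof -
    have "S = (\<Union>n::nat. S \<inter> cball 0 n)"
      using real_arch_simple by (auto simp: dist_norm)
    also have "\<dots> \<in> sigma_sets UNIV (range cell)"
      using that by (intro S.countable_UN) (auto intro!: compact_in_sigma_cells sep closed_Int_compact)
    finally show ?thesis .
  qed
  then show "sets borel \<subseteq> sigma_sets UNIV (range cell)"
    unfolding borel_eq_closed by (subst sets_measure_of) (use S.sigma_sets_subset[of "Collect closed"] in auto)
  have "cell l \<in> sets borel" for l
  proof -
    have "cell l = (\<Inter>p\<in>set l. {x. snd p \<le> exp (- sq_dist \<kappa> x (fst p))})"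
      by (force simp: cell_def)
    also have "closed \<dots>"
      by (intro closed_INT ballI closed_Collect_le continuous_intros)
    finally have "closed (cell l)" .
    then show ?thesis by simp
  qed
  then show "sigma_sets UNIV (range cell) \<subseteq> sets borel"
    by (intro sets.sigma_sets_subset') auto
qed

text \<open>The signed measure vanishes on an intersection-stable generator by
  \<open>annihilated_cell\<close>, hence on all Borel sets; passing to complements uses its total
  mass 0.\<close>

lemma dist_energy_eq_0_imp:
  assumes zero: "dist_energy = 0" and sep: "\<And>x y. sq_dist \<kappa> x y = 0 \<Longrightarrow> x = y"
    and A: "A \<in> sets borel"
  shows "(\<integral>w. g w * indicator A (X w) \<partial>M) = 0"
proof -
  have sets_eq: "sets borel = sigma_sets UNIV (range cell)"
    using sep by (rule borel_eq_sigma_cells)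
  have int: "integrable M (\<lambda>w. g w * indicator B (X w))" if [measurable]: "B \<in> sets borel" for B
    using g_bound G_nonneg
    by (intro integrable_const_bound[of _ G]) (auto simp: indicator_def)
  have cells_UNIV: "range cell \<subseteq> Pow UNIV" by simp
  have g_int: "integrable M g"
    using int[of UNIV] by simp
  show ?thesis
    using Int_stable_cells cells_UNIV A[unfolded sets_eq]
  proof (induction rule: sigma_sets_induct_disjoint)
    case (basic A)
    then obtain l where "A = cell l" by blast
    with annihilated_cell[OF zero, of l] show ?case
      unfolding annihilated_def by (elim conjE allE[of _ "[]"]) simp
  next
    case (compl A)
    then have [measurable]: "A \<in> sets borel" using sets_eq by simp
    have "(\<integral>w. g w * indicator (UNIV - A) (X w) \<partial>M) = (\<integral>w. g w - g w * indicator A (X w) \<partial>M)"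
      by (intro Bochner_Integration.integral_cong refl) (simp add: indicator_def)
    also have "\<dots> = 0"
      using g_int int[of A] g_mean compl by simp
    finally show ?case .
  next
    case (union A)
    then have [measurable]: "A i \<in> sets borel" for i using sets_eq by auto
    let ?B = "\<lambda>i. X -` A i \<inter> space M"
    have eq: "(\<integral>w. g w * indicator D (X w) \<partial>M) = (LINT w : X -` D \<inter> space M | M. g w)" for D
      unfolding set_lebesgue_integral_def
      by (intro Bochner_Integration.integral_cong refl) (simp add: indicator_def)
    have "(LINT w : (\<Union>i. ?B i) | M. g w) = (\<Sum>i. LINT w : ?B i | M. g w)"
    proof (rule lebesgue_integral_countable_add)
      show "set_integrable M (\<Union>i. ?B i) g"
        unfolding set_integrable_def using g_int by (intro integrable_mult_indicator) auto
      show "?B i \<inter> ?B j = {}" if "i \<noteq> j" for i j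
        using union(1) that unfolding disjoint_family_on_def by blast
    qed measurable
    moreover have "(\<Union>i. ?B i) = X -` (\<Union>i. A i) \<inter> space M" by blast
    ultimately show ?case using union(3) unfolding eq by simp
  qed simp_all
qed

subsection \<open>Generalized distance covariance\<close>

lemma expected_dist_iterated:
  assumes P: "prob_space P" "sets P = sets borel" and Q: "prob_space Q" "sets Q = sets borel"
  shows "expected_dist \<kappa> P Q = (\<integral>x. \<integral>y. kernel_dist \<kappa> x y \<partial>Q \<partial>P)"
    and "integrable (P \<Otimes>\<^sub>M Q) (\<lambda>(x, y). kernel_dist \<kappa> x y)"
proof -
  interpret P: prob_space P by fact
  interpret Q: prob_space Q by fact
  interpret PQ: pair_prob_space P Q ..
  note [measurable_cong] = P(2) Q(2)
  show int: "integrable (P \<Otimes>\<^sub>M Q) (\<lambda>(x, y). kernel_dist \<kappa> x y)"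
    using kernel_dist_bound by (intro PQ.P.integrable_const_bound[of _ "sqrt (4 * C)"]) auto
  show "expected_dist \<kappa> P Q = (\<integral>x. \<integral>y. kernel_dist \<kappa> x y \<partial>Q \<partial>P)"
    unfolding expected_dist_def by (rule PQ.integral_fst[OF int, symmetric])
qed

text \<open>Through densities on the common sample space, the expectations for different pairs of
  laws become values of one bilinear form.\<close>

lemma expected_dist_density:
  fixes a b :: "'a \<Rightarrow> real"
  assumes [measurable]: "a \<in> borel_measurable M" "b \<in> borel_measurable M"
    and nonneg: "\<And>w. 0 \<le> a w" "\<And>w. 0 \<le> b w"
    and prob: "prob_space (density M a)" "prob_space (density M b)"
  shows "expected_dist \<kappa> (distr (density M a) borel X) (distr (density M b) borel X) =
    (\<integral>w. \<integral>w'. a w * b w' * kernel_dist \<kappa> (X w) (X w') \<partial>M \<partial>M)"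
proof -
  let ?P = "distr (density M a) borel X" and ?Q = "distr (density M b) borel X"
  have P: "prob_space ?P" "prob_space ?Q"
    using prob by (auto intro!: prob_space.prob_space_distr)
  interpret Q: prob_space ?Q by fact
  have "expected_dist \<kappa> ?P ?Q = (\<integral>x. \<integral>y. kernel_dist \<kappa> x y \<partial>?Q \<partial>?P)"
    using P by (intro expected_dist_iterated) auto
  also have "\<dots> = (\<integral>w. a w * (\<integral>y. kernel_dist \<kappa> (X w) y \<partial>?Q) \<partial>M)"
    by (simp add: integral_distr integral_density nonneg)
  also have "\<dots> = (\<integral>w. \<integral>w'. a w * b w' * kernel_dist \<kappa> (X w) (X w') \<partial>M \<partial>M)"
    by (simp add: integral_distr integral_density nonneg mult.assoc flip: integral_mult_right_zero)
  finally show ?thesis .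
qed

lemma uniform_measure_eq_density:
  assumes "A \<in> events" "0 < prob A"
  shows "uniform_measure M A = density M (\<lambda>w. ennreal (indicator A w / prob A))"
  unfolding uniform_measure_def
proof (intro arg_cong[where f="density M"] ext)
  show "indicator A w / emeasure M A = ennreal (indicator A w / prob A)" for w
    using divide_ennreal[of "indicator A w" "prob A"] assms(2)
    by (simp add: emeasure_eq_measure ennreal_indicator)
qed

text \<open>With \<open>q\<close> the density of the conditioned measure, \<open>g\<close> is
  \<open>q - 1\<close>. Bilinearity and symmetry of \<open>e\<close> then expand
  \<open>dist_energy\<close> into the three expectations.\<close>

lemma dist_energy_event:
  assumes A [measurable]: "A \<in> events" and pos: "0 < prob A"
    and g: "g = (\<lambda>w. indicator A w / prob A - 1)"
  shows "2 * expected_dist \<kappa> (distr (uniform_measure M A) borel X) (distr M borel X)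
      - expected_dist \<kappa> (distr (uniform_measure M A) borel X) (distr (uniform_measure M A) borel X)
      - expected_dist \<kappa> (distr M borel X) (distr M borel X) = - dist_energy"
proof -
  interpret MM: pair_prob_space M M ..
  define q where "q w = indicator A w / prob A" for w
  have q: "g w = q w - 1" for w by (simp add: g q_def)
  have [measurable]: "q \<in> borel_measurable M" unfolding q_def by measurable
  have q_nonneg: "0 \<le> q w" and q_le: "q w \<le> 1 / prob A" for w
    using pos by (auto simp: q_def indicator_def)
  have uni: "uniform_measure M A = density M (\<lambda>w. ennreal (q w))"
    unfolding q_def by (rule uniform_measure_eq_density[OF A pos])
  have one: "M = density M (\<lambda>w. ennreal 1)"
    by (simp add: density_1)
  have prob: "prob_space (density M (\<lambda>w. ennreal (q w)))" "prob_space (density M (\<lambda>w. ennreal 1))"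
    using prob_space_uniform_measure[of M A] pos prob_space_axioms
    unfolding uni[symmetric] one[symmetric] by (auto simp: emeasure_eq_measure)
  define e where "e a b = (\<integral>(w, w'). a w * b w' * kernel_dist \<kappa> (X w) (X w') \<partial>(M \<Otimes>\<^sub>M M))"
    for a b :: "'a \<Rightarrow> real"
  have int: "integrable (M \<Otimes>\<^sub>M M) (\<lambda>(w, w'). a w * b w' * kernel_dist \<kappa> (X w) (X w'))"
    if [measurable]: "a \<in> borel_measurable M" "b \<in> borel_measurable M"
      and "\<And>w. \<bar>a w\<bar> \<le> c" "\<And>w. \<bar>b w\<bar> \<le> c" for a b and c :: real
  proof (rule MM.P.integrable_const_bound)
    have "\<bar>a w * b w' * kernel_dist \<kappa> (X w) (X w')\<bar> \<le> c * c * sqrt (4 * C)" for w w'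
      unfolding abs_mult using that(3)[of w] that(4)[of w'] kernel_dist_bound
      by (intro mult_mono) (auto intro: order_trans[OF abs_ge_zero])
    then show "AE p in M \<Otimes>\<^sub>M M. norm (case p of (w, w') \<Rightarrow> a w * b w' * kernel_dist \<kappa> (X w) (X w')) \<le> c * c * sqrt (4 * C)"
      by auto
  qed measurable
  \<comment> \<open>A common bound for \<open>q\<close> and for the constant density 1.\<close>
  define c where "c = 1 / prob A + 1"
  have c: "\<bar>q w\<bar> \<le> c" "\<bar>1::real\<bar> \<le> c" for w
    using q_nonneg[of w] q_le[of w] pos by (auto simp: c_def)
  have meas: "q \<in> borel_measurable M" "(\<lambda>_. 1 :: real) \<in> borel_measurable M"
    by measurable
  note ints = int[OF meas(1) meas(1) c(1) c(1)] int[OF meas(1) meas(2) c(1) c(2)]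
    int[OF meas(2) meas(1) c(2) c(1)] int[OF meas(2) meas(2) c(2) c(2)]
  have swap: "e (\<lambda>_. 1) q = e q (\<lambda>_. 1)"
  proof -
    have comm: "kernel_dist \<kappa> x y = kernel_dist \<kappa> y x" for x y
      unfolding kernel_dist_eq by (simp only: sq_dist_commute[OF pd, of x y])
    have "e (\<lambda>_. 1) q = (\<integral>(w, w'). q w' * 1 * kernel_dist \<kappa> (X w') (X w) \<partial>(M \<Otimes>\<^sub>M M))"
      unfolding e_def by (subst comm) simp
    also have "\<dots> = e q (\<lambda>_. 1)"
      unfolding e_def using MM.integral_product_swap[of "\<lambda>(w, w'). q w * 1 * kernel_dist \<kappa> (X w) (X w')"]
      by simp
    finally show ?thesis .
  qed
  have "dist_energy = (\<integral>(w, w'). g w * g w' * kernel_dist \<kappa> (X w) (X w') \<partial>(M \<Otimes>\<^sub>M M))"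
    unfolding dist_energy_def by (rule MM.integral_fst[OF integrable_gg[OF _ kernel_dist_bound]]) measurable
  also have "\<dots> = (\<integral>p. (case p of (w, w') \<Rightarrow> q w * q w' * kernel_dist \<kappa> (X w) (X w'))
      - (case p of (w, w') \<Rightarrow> q w * 1 * kernel_dist \<kappa> (X w) (X w'))
      - (case p of (w, w') \<Rightarrow> 1 * q w' * kernel_dist \<kappa> (X w) (X w'))
      + (case p of (w, w') \<Rightarrow> 1 * 1 * kernel_dist \<kappa> (X w) (X w')) \<partial>(M \<Otimes>\<^sub>M M))"
    by (intro Bochner_Integration.integral_cong refl) (simp add: q algebra_simps split: prod.split)
  also have "\<dots> = e q q - e q (\<lambda>_. 1) - e (\<lambda>_. 1) q + e (\<lambda>_. 1) (\<lambda>_. 1)"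
    unfolding e_def using ints
    by (simp only: Bochner_Integration.integral_add Bochner_Integration.integral_diff
        Bochner_Integration.integrable_diff)
  finally have de: "dist_energy = e q q - 2 * e q (\<lambda>_. 1) + e (\<lambda>_. 1) (\<lambda>_. 1)"
    unfolding swap by simp
  have fst: "(\<integral>w. \<integral>w'. a w * b w' * kernel_dist \<kappa> (X w) (X w') \<partial>M \<partial>M) = e a b"
    if "integrable (M \<Otimes>\<^sub>M M) (\<lambda>(w, w'). a w * b w' * kernel_dist \<kappa> (X w) (X w'))" for a b
    unfolding e_def by (rule MM.integral_fst[OF that])
  have "expected_dist \<kappa> (distr (uniform_measure M A) borel X) (distr (uniform_measure M A) borel X) = e q q"
    unfolding uni using expected_dist_density[of q q] q_nonneg prob fst[OF ints(1)] by simp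
  moreover have "expected_dist \<kappa> (distr (uniform_measure M A) borel X) (distr M borel X) = e q (\<lambda>_. 1)"
    unfolding uni using expected_dist_density[of q "\<lambda>_. 1"] q_nonneg prob fst[OF ints(2)]
    by (simp add: density_1)
  moreover have "expected_dist \<kappa> (distr M borel X) (distr M borel X) = e (\<lambda>_. 1) (\<lambda>_. 1)"
    using expected_dist_density[of "\<lambda>_. 1" "\<lambda>_. 1"] prob fst[OF ints(4)]
    by (simp add: density_1)
  ultimately show ?thesis using de by simp
qed

text \<open>The integral of \<open>g\<close> over a preimage of \<open>B\<close> is the difference
  between the conditional and the unconditional probability of \<open>B\<close>.\<close>

lemma dist_energy_event_eq_0_iff:
  assumes A [measurable]: "A \<in> events" and pos: "0 < prob A"
    and g: "g = (\<lambda>w. indicator A w / prob A - 1)"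
    and sep: "\<And>x y. sq_dist \<kappa> x y = 0 \<Longrightarrow> x = y"
  shows "dist_energy = 0 \<longleftrightarrow>
    (\<forall>B\<in>sets borel. prob ((X -` B \<inter> space M) \<inter> A) = prob (X -` B \<inter> space M) * prob A)"
proof (intro iffI ballI)
  fix B :: "'v set" assume zero: "dist_energy = 0" and B [measurable]: "B \<in> sets borel"
  let ?B = "X -` B \<inter> space M"
  have "0 = (\<integral>w. g w * indicator B (X w) \<partial>M)"
    using dist_energy_eq_0_imp[OF zero sep B] by simp
  also have "\<dots> = (\<integral>w. indicator (?B \<inter> A) w / prob A - indicator ?B w \<partial>M)"
    by (intro Bochner_Integration.integral_cong refl) (simp add: g indicator_def)
  also have "\<dots> = prob (?B \<inter> A) / prob A - prob ?B"
    by (subst Bochner_Integration.integral_diff) (auto simp: measurable_sets emeasure_eq_measure)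
  finally show "prob (?B \<inter> A) = prob ?B * prob A"
    using pos by (simp add: field_simps)
next
  assume indep: "\<forall>B\<in>sets borel. prob ((X -` B \<inter> space M) \<inter> A) = prob (X -` B \<inter> space M) * prob A"
  \<comment> \<open>Conditioning on an independent event leaves the law of \<open>X\<close>
    unchanged, so the three expected distances cancel.\<close>
  have "distr (uniform_measure M A) borel X = distr M borel X"
  proof (rule measure_eqI)
    fix B assume "B \<in> sets (distr (uniform_measure M A) borel X)"
    then have B [measurable]: "B \<in> sets borel" by simp
    have "emeasure (uniform_measure M A) (X -` B \<inter> space M) = prob (A \<inter> (X -` B \<inter> space M)) / prob A"
      using pos by (simp add: emeasure_eq_measure divide_ennreal)
    also have "\<dots> = emeasure M (X -` B \<inter> space M)"
      using indep B pos by (simp add: Int_commute emeasure_eq_measure)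
    finally show "emeasure (distr (uniform_measure M A) borel X) B = emeasure (distr M borel X) B"
      by (simp add: emeasure_distr)
  qed simp
  then show "dist_energy = 0"
    using dist_energy_event[OF A pos g] by simp
qed

text \<open>Two independent copies agree almost surely, so by Fubini one copy almost surely equals
  some fixed \<open>a\<close>.\<close>

lemma expected_dist_eq_0_imp_degenerate:
  assumes P: "prob_space P" "sets P = sets borel"
    and sep: "\<And>x y. sq_dist \<kappa> x y = 0 \<Longrightarrow> x = y"
    and zero: "expected_dist \<kappa> P P = 0"
  shows "degenerate P"
proof -
  interpret P: prob_space P by fact
  interpret PP: pair_prob_space P P ..
  note [measurable_cong] = P(2)
  have "AE p in P \<Otimes>\<^sub>M P. (case p of (x, y) \<Rightarrow> kernel_dist \<kappa> x y) = 0"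
    using zero unfolding expected_dist_def
    by (subst (asm) integral_nonneg_eq_0_iff_AE[OF expected_dist_iterated(2)[OF P P]])
      (auto simp: kernel_dist_eq sq_dist_nonneg[OF pd])
  then have "AE p in P \<Otimes>\<^sub>M P. fst p = snd p"
    by eventually_elim (auto simp: kernel_dist_eq intro: sep)
  then have "AE x in P. AE y in P. x = y"
    by (auto dest: PP.AE_pair)
  moreover have "ae_filter P \<noteq> bot"
    by (simp add: ae_filter_eq_bot_iff P.emeasure_space_1)
  ultimately obtain a where ae: "AE y in P. a = y"
    by (blast dest: eventually_happens')
  have "P = return borel a"
  proof (rule measure_eqI)
    fix A assume A: "A \<in> sets P"
    then have [measurable]: "A \<in> sets borel" using P(2) by simp
    have "emeasure P A = (\<integral>\<^sup>+y. indicator A y \<partial>P)" using A by simp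
    also have "\<dots> = (\<integral>\<^sup>+y. indicator A a \<partial>P)"
      using ae by (intro nn_integral_cong_AE) auto
    also have "\<dots> = emeasure (return borel a) A"
      using A P(2) by (simp add: P.emeasure_space_1)
    finally show "emeasure P A = emeasure (return borel a) A" .
  qed (simp add: P(2))
  then show ?thesis unfolding degenerate_def by blast
qed

end

section \<open>From single events to the categorical variable\<close>

lemma (in prob_space) kernel_energy_event:
  assumes "X \<in> borel_measurable M" and A [measurable]: "A \<in> events" and pos: "0 < prob A"
    and "positive_definite_kernel \<kappa>" "continuous_on UNIV (\<lambda>(x, y). \<kappa> x y)" "\<And>x y. \<bar>\<kappa> x y\<bar> \<le> C"
  shows "kernel_energy M X (\<lambda>w. indicator A w / prob A - 1) \<kappa> (1 / prob A + 1) C"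
proof (unfold_locales; (fact assms)?)
  show "\<bar>indicator A w / prob A - 1\<bar> \<le> 1 / prob A + 1" for w
    using pos by (auto simp: indicator_def abs_le_iff add_pos_pos)
  show "(\<integral>w. indicator A w / prob A - 1 \<partial>M) = 0"
    using pos by (subst Bochner_Integration.integral_diff) (auto simp: emeasure_eq_measure prob_space)
qed measurable

text \<open>Every event determined by \<open>Y\<close> is a finite union of label events, disjoint
  because \<open>L\<close> is injective, and probability is additive over it.\<close>

lemma (in prob_space) indep_random_variables_count_space_iff:
  assumes X [measurable]: "X \<in> measurable M S" and I: "finite I" and inj: "inj_on L I"
    and Y: "Y \<in> measurable M (count_space (L ` I))"
  shows "indep_random_variables M S X (count_space (L ` I)) Y \<longleftrightarrow>
    (\<forall>k\<in>I. \<forall>B\<in>sets S. prob ((X -` B \<inter> space M) \<inter> event_eq M Y (L k)) =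
       prob (X -` B \<inter> space M) * prob (event_eq M Y (L k)))" (is "?l \<longleftrightarrow> ?r")
proof
  have ev: "event_eq M Y (L k) = Y -` {L k} \<inter> space M" for k
    by (auto simp: event_eq_def)
  have ev_sets [measurable]: "event_eq M Y (L k) \<in> events" if "k \<in> I" for k
    unfolding ev using that by (intro measurable_sets[OF Y]) auto
  show ?r if ?l
  proof (intro ballI)
    fix k B assume k: "k \<in> I" and B: "B \<in> sets S"
    have "indep_set {X -` A \<inter> space M |A. A \<in> sets S} {Y -` B \<inter> space M |B. B \<in> sets (count_space (L ` I))}"
      using that unfolding indep_random_variables_def by blast
    then show "prob ((X -` B \<inter> space M) \<inter> event_eq M Y (L k)) =
       prob (X -` B \<inter> space M) * prob (event_eq M Y (L k))"
      unfolding ev by (rule indep_setD) (use k B in auto)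
  qed
  show ?l if r: ?r
    unfolding indep_random_variables_def indep_sets2_eq
  proof (intro conjI X Y ballI)
    show "{X -` A \<inter> space M |A. A \<in> sets S} \<subseteq> events" by auto
    show "{Y -` B \<inter> space M |B. B \<in> sets (count_space (L ` I))} \<subseteq> events"
      using measurable_sets[OF Y] by blast
    fix a b assume "a \<in> {X -` A \<inter> space M |A. A \<in> sets S}"
      "b \<in> {Y -` B \<inter> space M |B. B \<in> sets (count_space (L ` I))}"
    then obtain A B where a: "a = X -` A \<inter> space M" and A [measurable]: "A \<in> sets S"
      and b: "b = Y -` B \<inter> space M" and B: "B \<subseteq> L ` I" by auto
    define J where "J = {k\<in>I. L k \<in> B}"
    have J: "finite J" "J \<subseteq> I" using I by (auto simp: J_def)
    have disj: "disjoint_family_on (\<lambda>k. event_eq M Y (L k)) J"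
    proof -
      have "m = n" if "L m = L n" "m \<in> J" "n \<in> J" for m n
        using inj J(2) that by (meson inj_onD subsetD)
      then show ?thesis unfolding disjoint_family_on_def event_eq_def by force
    qed
    have b_eq: "b = (\<Union>k\<in>J. event_eq M Y (L k))"
      using B unfolding b J_def event_eq_def by (fastforce simp: image_iff subset_iff)
    have a_ev: "a \<in> events" unfolding a by measurable
    have "prob (a \<inter> b) = prob (\<Union>k\<in>J. a \<inter> event_eq M Y (L k))"
      unfolding b_eq by simp
    also have "\<dots> = (\<Sum>k\<in>J. prob (a \<inter> event_eq M Y (L k)))"
      using disj J a_ev by (intro finite_measure_finite_Union) (auto simp: disjoint_family_on_def)
    also have "\<dots> = (\<Sum>k\<in>J. prob a * prob (event_eq M Y (L k)))"
      using r J(2) A unfolding a by (intro sum.cong) auto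
    also have "\<dots> = prob a * prob b"
      unfolding b_eq sum_distrib_left[symmetric] using disj J
      by (subst finite_measure_finite_Union) auto
    finally show "prob (a \<inter> b) = prob a * prob b" .
  qed
qed

theorem theorem2:
  fixes M :: "'a measure"
    and X :: "'a \<Rightarrow> real ^ 'q"
    and Y :: "'a \<Rightarrow> 'l"
    and K :: nat
    and L :: "nat \<Rightarrow> 'l"
    and \<kappa> :: "real ^ 'q \<Rightarrow> real ^ 'q \<Rightarrow> real"
  assumes "prob_space M"
    and "X \<in> borel_measurable M"
    and "inj_on L {1..K}"
    and "Y \<in> measurable M (count_space (L ` {1..K}))"
    and "\<And>k. k \<in> {1..K} \<Longrightarrow> measure M (event_eq M Y (L k)) \<in> {0<..<1}"
    and "Mercer_kernel \<kappa>"
    and "bounded_kernel \<kappa>"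
    and "Metric_space UNIV (kernel_dist \<kappa>)"
  shows "(gCov \<kappa> M K L X Y = 0 \<longleftrightarrow>
            indep_random_variables M borel X (count_space (L ` {1..K})) Y) \<and>
         (\<not> degenerate (distribution_of M X) \<longrightarrow>
            (gCor \<kappa> M K L X Y = 0 \<longleftrightarrow>
               indep_random_variables M borel X (count_space (L ` {1..K})) Y))"
proof -
  interpret prob_space M by fact
  let ?A = "\<lambda>k. event_eq M Y (L k)"
  obtain C where C: "\<And>x y. \<bar>\<kappa> x y\<bar> \<le> C"
    using assms(7) unfolding bounded_kernel_def by blast
  have pd: "positive_definite_kernel \<kappa>" and cont: "continuous_on UNIV (\<lambda>(x, y). \<kappa> x y)"
    using assms(6) unfolding Mercer_kernel_def by auto
  \<comment> \<open>The metric assumption enters here: the kernel separates points.\<close>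
  have sep: "x = y" if "sq_dist \<kappa> x y = 0" for x y
    using Metric_space.zero[OF assms(8), of x y] that by (simp add: kernel_dist_def sq_dist_def)
  have ev: "?A k \<in> events" if "k \<in> {1..K}" for k
  proof -
    have "?A k = Y -` {L k} \<inter> space M" by (auto simp: event_eq_def)
    also have "\<dots> \<in> events" using that by (intro measurable_sets[OF assms(4)]) auto
    finally show ?thesis .
  qed
  have pos: "0 < prob (?A k)" if "k \<in> {1..K}" for k
    using assms(5)[OF that] by simp
  note energy = kernel_energy_event[OF assms(2) ev pos pd cont C]
  define D where "D k = 2 * expected_dist \<kappa> (cond_distribution M X Y (L k)) (distribution_of M X)
         - expected_dist \<kappa> (cond_distribution M X Y (L k)) (cond_distribution M X Y (L k))
         - expected_dist \<kappa> (distribution_of M X) (distribution_of M X)" for k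
  have D: "D k = - kernel_energy.dist_energy M X (\<lambda>w. indicator (?A k) w / prob (?A k) - 1) \<kappa>"
    if "k \<in> {1..K}" for k
    unfolding D_def cond_distribution_def distribution_of_def
    using kernel_energy.dist_energy_event[OF energy[OF that that] ev[OF that] pos[OF that] refl] .
  \<comment> \<open>All summands are nonnegative, so brackets of different labels cannot
    cancel.\<close>
  have "gCov \<kappa> M K L X Y = 0 \<longleftrightarrow> (\<forall>k\<in>{1..K}. prob (?A k) * D k = 0)"
    unfolding gCov_def D_def[symmetric]
    by (intro sum_nonneg_eq_0_iff mult_nonneg_nonneg)
      (simp_all add: D kernel_energy.dist_energy_nonpos[OF energy])
  also have "\<dots> \<longleftrightarrow> (\<forall>k\<in>{1..K}. \<forall>B\<in>sets borel.
      prob ((X -` B \<inter> space M) \<inter> ?A k) = prob (X -` B \<inter> space M) * prob (?A k))"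
  proof (rule ball_cong[OF refl])
    fix k assume k: "k \<in> {1..K}"
    show "(prob (?A k) * D k = 0) \<longleftrightarrow> (\<forall>B\<in>sets borel.
        prob ((X -` B \<inter> space M) \<inter> ?A k) = prob (X -` B \<inter> space M) * prob (?A k))"
      using kernel_energy.dist_energy_event_eq_0_iff[OF energy[OF k k] ev[OF k] pos[OF k] refl sep]
        pos[OF k] D[OF k] by simp
  qed
  also have "\<dots> \<longleftrightarrow> indep_random_variables M borel X (count_space (L ` {1..K})) Y"
    using indep_random_variables_count_space_iff[OF assms(2) _ assms(3,4)] by simp
  finally have cov: "gCov \<kappa> M K L X Y = 0 \<longleftrightarrow>
      indep_random_variables M borel X (count_space (L ` {1..K})) Y" .
  \<comment> \<open>A zero denominator would make the quotient 0 by convention and has to be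
    excluded.\<close>
  have "expected_dist \<kappa> (distribution_of M X) (distribution_of M X) \<noteq> 0"
    if "\<not> degenerate (distribution_of M X)"
  proof -
    \<comment> \<open>The sure event provides an instance of the locale; the conclusion drawn from
      it does not involve \<open>g\<close>.\<close>
    interpret kernel_energy M X "\<lambda>w. indicator (space M) w / prob (space M) - 1" \<kappa> "1 / prob (space M) + 1" C
      by (rule kernel_energy_event[OF assms(2) _ _ pd cont C]) (auto simp: prob_space)
    show ?thesis
      using expected_dist_eq_0_imp_degenerate[of "distribution_of M X"] sep that
        prob_space_distr[OF assms(2)] unfolding distribution_of_def by auto
  qed
  with cov show ?thesis unfolding gCor_def by simp
qed

end
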